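(* Let $N\ge 2$, $R\in(0,\infty)$, $\delta\in[0,R)$ and $\alpha>R$. Let $f:[\delta,R]\times[0,\alpha)\to[0,\infty)$ be continuous with $f(r,s)>0$ for all $(r,s)\in[\delta,R]\times(0,\alpha)$. Suppose that $\lim_{s\to0^+}\frac{f(r,s)}{s}=m(r)$ uniformly in $r\in[\delta,R]$, where $m\in C[\delta,R]$, $m(r)\ge0$ on $[\delta,R]$ and $m\not\equiv0$ on any subinterval of $[\delta,R]$. Let $\lambda_1(m,\delta)$ be the principal eigenvalue of $$-(r^{N-1}u')'=\lambda r^{N-1}m(r)u,\qquad u'(\delta)=u(R)=0.$$ Then there exists $\lambda_*\in(0,\lambda_1(m,\delta)]$ such that the problem $$(r^{N-1}\phi_1(u'))'+\lambda r^{N-1}f(r,u)=0\ \text{ on }(\delta,R),\qquad u'(\delta)=u(R)=0,$$ has no positive solution for all $\lambda\in(0,\lambda_* )$, and has at least one positive solution for all $\lambda>\lambda_1(m,\delta)$.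
   Context: $\phi_1(s)=\frac{s}{\sqrt{1-s^2}}$ for $|s|<1$. A positive solution is a function $u\in C^1[\delta,R]$ with values in $[0,\alpha)$ (where $f$ is defined), with $u>0$ on $[\delta,R)$, $|u'|<1$ on $[\delta,R]$ and $r^{N-1}\phi_1(u')$ continuously differentiable, satisfying the differential equation and the boundary conditions. *)

theory Defs
  imports "HOL-Analysis.Analysis"
begin

text \<open>Functions on a compact interval \<open>[a, b]\<close> are total functions of which only the
  values on \<open>[a, b]\<close> matter; hence derivatives are taken within \<open>[a, b]\<close>, one-sided at the
  end points. (The library's \<open>C1_differentiable_on\<close> uses two-sided derivatives there.)\<close>

definition has_C1_derivative :: "real \<Rightarrow> real \<Rightarrow> (real \<Rightarrow> real) \<Rightarrow> (real \<Rightarrow> real) \<Rightarrow> bool" where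
  "has_C1_derivative a b u u' \<longleftrightarrow>
     (\<forall>r\<in>{a..b}. (u has_real_derivative u' r) (at r within {a..b})) \<and> continuous_on {a..b} u'"

definition phi1 :: "real \<Rightarrow> real" where
  "phi1 s = s / sqrt (1 - s\<^sup>2)"

text \<open>Throughout, \<open>u'\<close> is the derivative of \<open>u\<close>, and \<open>w\<close> is the derivative of
  \<open>r\<^sup>N\<^sup>-\<^sup>1 \<phi>\<^sub>1(u')\<close>, respectively of \<open>r\<^sup>N\<^sup>-\<^sup>1 u'\<close>.\<close>

definition positive_solution ::
  "nat \<Rightarrow> real \<Rightarrow> real \<Rightarrow> real \<Rightarrow> (real \<Rightarrow> real \<Rightarrow> real) \<Rightarrow> real \<Rightarrow> (real \<Rightarrow> real) \<Rightarrow> bool" where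
  "positive_solution N \<delta> R \<alpha> f lam u \<longleftrightarrow>
     (\<forall>r\<in>{\<delta>..R}. u r \<in> {0..<\<alpha>}) \<and>
     (\<forall>r\<in>{\<delta>..<R}. u r > 0) \<and>
     (\<exists>u' w. has_C1_derivative \<delta> R u u' \<and>
        (\<forall>r\<in>{\<delta>..R}. \<bar>u' r\<bar> < 1) \<and>
        has_C1_derivative \<delta> R (\<lambda>r. r ^ (N - 1) * phi1 (u' r)) w \<and>
        (\<forall>r\<in>{\<delta><..<R}. w r + lam * r ^ (N - 1) * f r (u r) = 0) \<and>
        u' \<delta> = 0 \<and> u R = 0)"

definition eigenfunction ::
  "nat \<Rightarrow> real \<Rightarrow> real \<Rightarrow> (real \<Rightarrow> real) \<Rightarrow> real \<Rightarrow> (real \<Rightarrow> real) \<Rightarrow> bool" where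
  "eigenfunction N \<delta> R m lam u \<longleftrightarrow>
     (\<exists>r\<in>{\<delta>..R}. u r \<noteq> 0) \<and>
     (\<exists>u' w. has_C1_derivative \<delta> R u u' \<and>
        has_C1_derivative \<delta> R (\<lambda>r. r ^ (N - 1) * u' r) w \<and>
        (\<forall>r\<in>{\<delta><..<R}. - w r = lam * r ^ (N - 1) * m r * u r) \<and>
        u' \<delta> = 0 \<and> u R = 0)"

text \<open>As usual, the principal eigenvalue is the eigenvalue that has a positive eigenfunction.\<close>

definition principal_eigenvalue ::
  "nat \<Rightarrow> real \<Rightarrow> real \<Rightarrow> (real \<Rightarrow> real) \<Rightarrow> real \<Rightarrow> bool" where
  "principal_eigenvalue N \<delta> R m lam \<longleftrightarrow>
     (\<exists>u. eigenfunction N \<delta> R m lam u \<and> (\<forall>r\<in>{\<delta>..<R}. u r > 0))"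

end

theory Submission
  imports Defs "HOL-Complex_Analysis.Great_Picard"
begin

text \<open>A positive solution has \<open>|u'| < 1\<close> and \<open>u(R) = 0\<close>, so it takes values in \<open>[0, R]\<close>, where
  \<open>f(r, s) \<le> C s\<close> for some constant \<open>C\<close>. Integrating the equation twice bounds \<open>u(\<delta>)\<close> by
  \<open>\<lambda> C R\<^sup>2 u(\<delta>)\<close>, which excludes positive solutions for small \<open>\<lambda>\<close>
  (\<open>positive_solution_parameter_ge\<close>). As \<open>\<lambda>\<^sub>1 > 0\<close>, the minimum of \<open>\<lambda>\<^sub>1\<close> and \<open>1 / (C R\<^sup>2)\<close> can be
  taken for \<open>\<lambda>\<^sub>*\<close>.

  For \<open>\<lambda> > \<lambda>\<^sub>1\<close> a solution is found by shooting from \<open>\<delta>\<close>: solve the initial value problem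
  \<open>u(\<delta>) = a\<close>, \<open>u'(\<delta>) = 0\<close> and adjust \<open>a\<close> so that \<open>u(R) = 0\<close>. From the height \<open>a = R\<close> one has
  \<open>u(R) \<ge> 0\<close>, because \<open>|u'| < 1\<close>. From a small height \<open>\<epsilon>\<close> one has \<open>u(R) < 0\<close>, because the problem
  is then close to the linear one with weight \<open>m\<close>, and above \<open>\<lambda>\<^sub>1\<close> comparison with the principal
  eigenfunction shows that \<open>u\<close> crosses zero before \<open>R\<close>
  (\<open>small_radial_solutions_negative_at_R\<close>).

  As \<open>f\<close> is merely continuous, the initial value problem need not be uniquely solvable, and
  continuous dependence on \<open>a\<close> may fail. It is therefore replaced by Tonelli's problem, where the
  argument of \<open>u\<close> in the source term is delayed. This has exactly one solution for each \<open>a\<close>,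
  continuous in \<open>a\<close>, and the intermediate value theorem applies to it. As the delay tends to \<open>0\<close>,
  the Arzela--Ascoli theorem yields solutions of the original problem
  (\<open>delayed_solutions_accumulate\<close>, \<open>shooting\<close>). The limit starts at a height of at least \<open>\<epsilon>\<close>,
  so it is not the trivial solution, and then it is positive before \<open>R\<close> because its flux is
  strictly negative right after the start (\<open>radial_solution_positive\<close>).\<close>

section \<open>The inverse of \<open>\<phi>\<^sub>1\<close>\<close>

definition phi1_inv :: "real \<Rightarrow> real" where
  "phi1_inv y = y / sqrt (1 + y\<^sup>2)"

lemma phi1_inv_eq_sin_arctan: "phi1_inv y = sin (arctan y)"
  by (simp add: phi1_inv_def sin_arctan)

lemma abs_phi1_inv_less_1: "\<bar>phi1_inv y\<bar> < 1"
proof -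
  have "sqrt (y\<^sup>2) < sqrt (1 + y\<^sup>2)"
    by (rule real_sqrt_less_mono) simp
  moreover have "0 < sqrt (1 + y\<^sup>2)"
    by (simp add: add_pos_nonneg)
  ultimately show ?thesis
    unfolding phi1_inv_def by (simp add: abs_divide)
qed

lemma phi1_phi1_inv [simp]: "phi1 (phi1_inv y) = y"
proof -
  have pos: "0 < 1 + y\<^sup>2"
    by (simp add: add_pos_nonneg)
  have "1 - (phi1_inv y)\<^sup>2 = 1 / (1 + y\<^sup>2)"
    using pos by (simp add: phi1_inv_def power_divide field_simps)
  then have "phi1 (phi1_inv y) = phi1_inv y * sqrt (1 + y\<^sup>2)"
    by (simp add: phi1_def real_sqrt_divide)
  also have "\<dots> = y"
    using pos by (simp add: phi1_inv_def)
  finally show ?thesis .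
qed

lemma phi1_minus [simp]: "phi1 (- s) = - phi1 s"
  by (simp add: phi1_def)

lemma phi1_0 [simp]: "phi1 0 = 0"
  by (simp add: phi1_def)

lemma phi1_inv_0 [simp]: "phi1_inv 0 = 0"
  by (simp add: phi1_inv_def)

lemma continuous_on_phi1_inv [continuous_intros]:
  fixes g :: "real \<Rightarrow> real"
  shows "continuous_on S g \<Longrightarrow> continuous_on S (\<lambda>x. phi1_inv (g x))"
  unfolding phi1_inv_eq_sin_arctan by (intro continuous_on_sin continuous_on_arctan)

lemma phi1_inv_lipschitz: "\<bar>phi1_inv x - phi1_inv y\<bar> \<le> \<bar>x - y\<bar>"
proof -
  have der: "(phi1_inv has_real_derivative cos (arctan t) * inverse (1 + t\<^sup>2)) (at t)" for t
    unfolding phi1_inv_eq_sin_arctan [abs_def]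
    by (rule DERIV_chain2 [OF DERIV_sin DERIV_arctan])
  have bnd: "norm (cos (arctan t) * inverse (1 + t\<^sup>2)) \<le> 1" for t :: real
  proof -
    have "inverse (1 + t\<^sup>2) \<le> 1"
      by (simp add: inverse_eq_divide add_pos_nonneg)
    then show ?thesis
      using abs_cos_le_one [of "arctan t"]
      by (simp add: abs_mult mult_le_one)
  qed
  have "norm (phi1_inv x - phi1_inv y) \<le> 1 * norm (x - y)"
    by (rule field_differentiable_bound [of UNIV _ "\<lambda>t. cos (arctan t) * inverse (1 + t\<^sup>2)"])
      (use der bnd in auto)
  then show ?thesis by simp
qed

lemma phi1_nonpos_iff:
  assumes "\<bar>s\<bar> < 1"
  shows "phi1 s \<le> 0 \<longleftrightarrow> s \<le> 0"
proof -
  have "0 < sqrt (1 - s\<^sup>2)"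
    using assms by (simp add: abs_square_less_1)
  then show ?thesis
    by (simp add: phi1_def divide_le_0_iff)
qed

text \<open>Solutions of small height have small slopes, for which \<open>\<phi>\<^sub>1\<close> is the identity up to higher
  order. The difference is cubic, but a quadratic bound is enough for the comparison with the linear
  problem. Only \<open>s \<le> 0\<close> matters, as all solutions are nonincreasing.\<close>

lemma phi1_le_self:
  assumes "-1 < s" "s \<le> 0"
  shows "phi1 s \<le> s"
proof -
  have "s\<^sup>2 < 1"
    using assms by (simp add: abs_square_less_1)
  then have "0 < sqrt (1 - s\<^sup>2)" "sqrt (1 - s\<^sup>2) \<le> 1"
    by auto
  then show ?thesis
    using mult_left_mono_neg [of "sqrt (1 - s\<^sup>2)" 1 s] assms
    by (simp add: phi1_def pos_divide_le_eq)
qed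

lemma self_minus_phi1_le:
  assumes "-1 < s" "s \<le> 0"
  shows "s - phi1 s \<le> (phi1 s)\<^sup>2"
proof -
  define c where "c = sqrt (1 - s\<^sup>2)"
  have s1: "s\<^sup>2 < 1"
    using assms by (simp add: abs_square_less_1)
  then have c: "0 < c" "c\<^sup>2 = 1 - s\<^sup>2"
    by (auto simp: c_def)
  \<comment> \<open>as \<open>c\<^sup>2 + s\<^sup>2 = 1\<close> and the mixed term \<open>- 2 c s\<close> is nonnegative\<close>
  have "1\<^sup>2 \<le> (c - s)\<^sup>2"
    using c assms by (simp add: power2_diff mult_nonneg_nonpos)
  then have "1 \<le> c - s"
    using c assms power2_le_imp_le [of 1 "c - s"] by simp
  have "s * c\<^sup>2 - s * c \<le> s\<^sup>2"
  proof -
    have "(- s * c) * (1 - c) \<le> (- s * c) * (- s)"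
      using \<open>1 \<le> c - s\<close> c assms
      by (intro mult_left_mono) (auto simp: mult_nonpos_nonneg)
    also have "\<dots> = s\<^sup>2 * c" by (simp add: power2_eq_square)
    also have "\<dots> \<le> s\<^sup>2 * 1"
      using c by (intro mult_left_mono) (auto simp: c_def)
    finally show ?thesis by (simp add: algebra_simps power2_eq_square)
  qed
  then have "(s * c\<^sup>2 - s * c) / c\<^sup>2 \<le> s\<^sup>2 / c\<^sup>2"
    by (rule divide_right_mono) simp
  also have "(s * c\<^sup>2 - s * c) / c\<^sup>2 = s - s / c"
    using c(1) by (simp add: field_simps power2_eq_square)
  finally show ?thesis
    by (simp add: phi1_def c_def [symmetric] power_divide)
qed


section \<open>Monotonicity arguments for radial fluxes\<close>

lemma has_C1_derivativeD:
  assumes "has_C1_derivative a b u u'"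
  shows has_C1_derivative_interior:
      "\<And>r. a < r \<Longrightarrow> r < b \<Longrightarrow> (u has_real_derivative u' r) (at r)"
    and has_C1_derivative_continuous: "continuous_on {a..b} u"
proof -
  show "(u has_real_derivative u' r) (at r)" if "a < r" "r < b" for r
    using assms that unfolding has_C1_derivative_def
    by (metis at_within_Icc_at atLeastAtMost_iff less_eq_real_def)
  show "continuous_on {a..b} u"
    using assms by (auto simp: has_C1_derivative_def intro: DERIV_continuous_on)
qed

lemma has_C1_derivative_minus:
  assumes "has_C1_derivative a b u u'"
  shows "has_C1_derivative a b (\<lambda>r. - u r) (\<lambda>r. - u' r)"
  using assms unfolding has_C1_derivative_def
  by (auto intro!: derivative_eq_intros continuous_intros)

lemma antimono_on_Icc_of_DERIV:
  fixes P :: "real \<Rightarrow> real"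
  assumes "continuous_on {a..b} P"
    and "\<And>x. a < x \<Longrightarrow> x < b \<Longrightarrow> (P has_real_derivative w x) (at x)"
    and "\<And>x. a < x \<Longrightarrow> x < b \<Longrightarrow> w x \<le> 0"
    and "a \<le> x" "x \<le> y" "y \<le> b"
  shows "P y \<le> P x"
proof (rule DERIV_nonpos_imp_decreasing_open [OF \<open>x \<le> y\<close>])
  show "\<exists>d. (P has_real_derivative d) (at t) \<and> d \<le> 0" if "x < t" "t < y" for t
    using assms(2,3) [of t] that assms(4-6) by auto
  show "continuous_on {x..y} P"
    using continuous_on_subset [OF assms(1), of "{x..y}"] assms(4-6) by simp
qed

lemma has_C1_derivative_drop_le:
  assumes u: "has_C1_derivative a b u u'"
    and L: "\<And>t. a < t \<Longrightarrow> t < b \<Longrightarrow> - L \<le> u' t"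
    and xy: "a \<le> x" "x \<le> y" "y \<le> b"
  shows "u x - u y \<le> L * (y - x)"
proof -
  have "- u y - L * y \<le> - u x - L * x"
  proof (rule antimono_on_Icc_of_DERIV
      [where P = "\<lambda>r. - u r - L * r" and a = a and b = b and w = "\<lambda>r. - u' r - L"])
    show "continuous_on {a..b} (\<lambda>r. - u r - L * r)"
      by (intro continuous_intros has_C1_derivative_continuous [OF u])
    show "((\<lambda>r. - u r - L * r) has_real_derivative - u' t - L) (at t)" if "a < t" "t < b" for t
      using DERIV_diff [OF DERIV_minus [OF has_C1_derivative_interior [OF u that]]
          DERIV_cmult [OF DERIV_ident, of L]] by simp
    show "- u' t - L \<le> 0" if "a < t" "t < b" for t
      using L [OF that] by simp
  qed (use xy in auto)
  then show ?thesis by (simp add: algebra_simps)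
qed

lemma strict_decrease_of_DERIV_neg_somewhere:
  fixes P :: "real \<Rightarrow> real"
  assumes cont: "continuous_on {a..b} P"
    and der: "\<And>x. a < x \<Longrightarrow> x < b \<Longrightarrow> (P has_real_derivative w x) (at x)"
    and le: "\<And>x. a < x \<Longrightarrow> x < b \<Longrightarrow> w x \<le> 0"
    and c: "a < c" "c < b" "w c < 0"
  shows "P b < P a"
proof -
  obtain d where d: "0 < d" "\<And>h. 0 < h \<Longrightarrow> h < d \<Longrightarrow> P (c + h) < P c"
    using DERIV_neg_dec_right [OF der [OF c(1,2)] c(3)] by auto
  define h where "h = min (d / 2) (b - c)"
  have h: "0 < h" "h < d" "c + h \<le> b"
    using d c by (auto simp: h_def)
  have "P b \<le> P (c + h)"
    using antimono_on_Icc_of_DERIV [OF cont der le, of "c + h" b] h c by auto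
  also have "\<dots> < P c" using d h by blast
  also have "\<dots> \<le> P a"
    using antimono_on_Icc_of_DERIV [OF cont der le, of a c] c by auto
  finally show ?thesis .
qed

lemma continuous_on_Icc_bounded_above:
  fixes g :: "real \<Rightarrow> real"
  assumes "continuous_on {a..b} g"
  obtains B where "0 < B" "\<And>r. a \<le> r \<Longrightarrow> r \<le> b \<Longrightarrow> g r \<le> B"
proof -
  have "bounded (g ` {a..b})"
    using assms by (intro compact_imp_bounded compact_continuous_image) auto
  then obtain B where "0 < B" "\<forall>x\<in>g ` {a..b}. norm x \<le> B"
    using bounded_pos by blast
  then show ?thesis
    by (intro that [of B]) (auto simp: abs_le_iff)
qed

text \<open>Because \<open>t\<^sup>k \<le> r\<^sup>k\<close> for \<open>t \<le> r\<close>, integrating a bound for \<open>(r\<^sup>k g)'\<close> from \<open>\<delta>\<close> and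
  dividing by \<open>r\<^sup>k\<close> costs no negative power of \<open>r\<close>; so the estimate also covers the
  singular case \<open>\<delta> = 0\<close>.\<close>

lemma radial_flux_le:
  fixes g :: "real \<Rightarrow> real"
  assumes \<delta>: "0 \<le> \<delta>" and g0: "g \<delta> = 0" and B: "0 \<le> B"
    and C1: "has_C1_derivative \<delta> R (\<lambda>r. r ^ k * g r) w"
    and le: "\<And>r. \<delta> < r \<Longrightarrow> r < R \<Longrightarrow> w r \<le> B * r ^ k"
    and r: "\<delta> \<le> r" "r \<le> R"
  shows "g r \<le> B * (r - \<delta>)"
proof (cases "r = \<delta>")
  case False
  then have "\<delta> < r" using r by simp
  have rk: "0 < r ^ k" using \<open>\<delta> < r\<close> \<delta> by simp
  define H where "H = (\<lambda>t. t ^ k * g t - B * r ^ k * t)"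
  have "H r \<le> H \<delta>"
  proof (rule antimono_on_Icc_of_DERIV
      [where P = H and a = \<delta> and b = r and w = "\<lambda>t. w t - B * r ^ k"])
    show "continuous_on {\<delta>..r} H"
      unfolding H_def
      using continuous_on_subset [OF has_C1_derivative_continuous [OF C1], of "{\<delta>..r}"] r
      by (auto intro!: continuous_on_diff continuous_on_mult_left continuous_on_id)
    fix t assume t: "\<delta> < t" "t < r"
    show "(H has_real_derivative w t - B * r ^ k) (at t)"
      using DERIV_diff [OF has_C1_derivative_interior [OF C1, of t]
          DERIV_cmult [OF DERIV_ident, of "B * r ^ k"]] t r
      by (simp add: H_def)
    have "t ^ k \<le> r ^ k"
      using t \<delta> by (intro power_mono) auto
    then have "B * t ^ k \<le> B * r ^ k"
      using B by (rule mult_left_mono)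
    then show "w t - B * r ^ k \<le> 0"
      using le [of t] t r by simp
  qed (use r in auto)
  then have "r ^ k * g r \<le> r ^ k * (B * (r - \<delta>))"
    by (simp add: H_def g0 algebra_simps)
  then show ?thesis using rk by simp
qed (use g0 in simp)

lemma radial_flux_ge:
  fixes g :: "real \<Rightarrow> real"
  assumes "0 \<le> \<delta>" and "g \<delta> = 0" and "0 \<le> B"
    and "has_C1_derivative \<delta> R (\<lambda>r. r ^ k * g r) w"
    and "\<And>r. \<delta> < r \<Longrightarrow> r < R \<Longrightarrow> - (B * r ^ k) \<le> w r"
    and "\<delta> \<le> r" "r \<le> R"
  shows "- (B * (r - \<delta>)) \<le> g r"
  using radial_flux_le [of \<delta> "\<lambda>r. - g r" B R k "\<lambda>r. - w r" r]
    has_C1_derivative_minus [OF assms(4)] assms by force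


section \<open>Radial solutions\<close>

text \<open>In a \<^emph>\<open>radial solution\<close> the parameter \<open>\<lambda>\<close> is part of \<open>F\<close>, and nothing is required at the right
  end point: this is the initial value problem in which one shoots from \<open>\<delta>\<close>.\<close>

definition radial_solution ::
  "nat \<Rightarrow> real \<Rightarrow> real \<Rightarrow> (real \<Rightarrow> real \<Rightarrow> real) \<Rightarrow> (real \<Rightarrow> real) \<Rightarrow> (real \<Rightarrow> real) \<Rightarrow> bool" where
  "radial_solution N \<delta> R F u u' \<longleftrightarrow>
     has_C1_derivative \<delta> R u u' \<and> (\<forall>r\<in>{\<delta>..R}. \<bar>u' r\<bar> < 1) \<and> u' \<delta> = 0 \<and>
     (\<exists>w. has_C1_derivative \<delta> R (\<lambda>r. r ^ (N - 1) * phi1 (u' r)) w \<and>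
       (\<forall>r\<in>{\<delta><..<R}. w r = - (r ^ (N - 1) * F r (u r))))"

context
  fixes N :: nat and \<delta> R :: real and F :: "real \<Rightarrow> real \<Rightarrow> real" and u u' :: "real \<Rightarrow> real"
  assumes \<delta>: "0 \<le> \<delta>" and sol: "radial_solution N \<delta> R F u u'"
    and F_nonneg: "\<And>r. \<delta> < r \<Longrightarrow> r < R \<Longrightarrow> 0 \<le> F r (u r)"
begin

lemma radial_solution_slope_nonpos:
  assumes "\<delta> \<le> r" "r \<le> R"
  shows "u' r \<le> 0"
proof -
  obtain w where w: "has_C1_derivative \<delta> R (\<lambda>r. r ^ (N - 1) * phi1 (u' r)) w"
      "\<And>r. \<delta> < r \<Longrightarrow> r < R \<Longrightarrow> w r = - (r ^ (N - 1) * F r (u r))"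
    using sol by (auto simp: radial_solution_def)
  have "phi1 (u' r) \<le> 0 * (r - \<delta>)"
  proof (rule radial_flux_le [where k = "N - 1" and R = R and w = w])
    show "w t \<le> 0 * t ^ (N - 1)" if "\<delta> < t" "t < R" for t
      using w(2) [of t] F_nonneg [of t] that \<delta> by simp
  qed (use \<delta> sol w assms in \<open>auto simp: radial_solution_def\<close>)
  then show ?thesis
    using phi1_nonpos_iff [of "u' r"] sol assms by (auto simp: radial_solution_def)
qed

lemma radial_solution_nonincreasing:
  assumes "\<delta> \<le> x" "x \<le> y" "y \<le> R"
  shows "u y \<le> u x"
proof (rule antimono_on_Icc_of_DERIV [where P = u and a = \<delta> and b = R and w = u'])
  have u: "has_C1_derivative \<delta> R u u'"
    using sol by (simp add: radial_solution_def)
  show "continuous_on {\<delta>..R} u"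
    by (rule has_C1_derivative_continuous [OF u])
  show "(u has_real_derivative u' t) (at t)" if "\<delta> < t" "t < R" for t
    by (rule has_C1_derivative_interior [OF u that])
qed (use assms radial_solution_slope_nonpos in auto)

lemma radial_solution_slope_ge:
  assumes B: "0 \<le> B" "\<And>r. \<delta> < r \<Longrightarrow> r < R \<Longrightarrow> F r (u r) \<le> B"
    and r: "\<delta> \<le> r" "r \<le> R"
  shows "- (B * (r - \<delta>)) \<le> phi1 (u' r)" "- (B * (r - \<delta>)) \<le> u' r"
proof -
  obtain w where w: "has_C1_derivative \<delta> R (\<lambda>r. r ^ (N - 1) * phi1 (u' r)) w"
      "\<And>r. \<delta> < r \<Longrightarrow> r < R \<Longrightarrow> w r = - (r ^ (N - 1) * F r (u r))"
    using sol by (auto simp: radial_solution_def)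
  show *: "- (B * (r - \<delta>)) \<le> phi1 (u' r)"
  proof (rule radial_flux_ge [where k = "N - 1" and R = R and w = w])
    show "- (B * t ^ (N - 1)) \<le> w t" if "\<delta> < t" "t < R" for t
      using w(2) [of t] mult_right_mono [OF B(2) [of t], of "t ^ (N - 1)"] that \<delta>
      by (simp add: mult.commute)
  qed (use \<delta> sol w B r in \<open>auto simp: radial_solution_def\<close>)
  have "-1 < u' r"
    using sol r by (force simp: radial_solution_def)
  with * show "- (B * (r - \<delta>)) \<le> u' r"
    using phi1_le_self [of "u' r"] radial_solution_slope_nonpos [of r] r by linarith
qed

text \<open>Near \<open>\<delta>\<close> the solution is positive, so the flux becomes negative immediately and stays so;
  hence \<open>u\<close> is strictly decreasing and cannot vanish before \<open>R\<close>.\<close>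

lemma radial_solution_positive:
  assumes pos: "\<And>r s. \<delta> < r \<Longrightarrow> r < R \<Longrightarrow> 0 < s \<Longrightarrow> s \<le> u \<delta> \<Longrightarrow> 0 < F r s"
    and u\<delta>: "0 < u \<delta>" and uR: "u R = 0" and r: "\<delta> \<le> r" "r < R"
  shows "0 < u r"
proof -
  obtain w where w: "has_C1_derivative \<delta> R (\<lambda>r. r ^ (N - 1) * phi1 (u' r)) w"
      "\<And>r. \<delta> < r \<Longrightarrow> r < R \<Longrightarrow> w r = - (r ^ (N - 1) * F r (u r))"
    using sol by (auto simp: radial_solution_def)
  have u: "has_C1_derivative \<delta> R u u'" and u'\<delta>: "u' \<delta> = 0"
    using sol by (auto simp: radial_solution_def)
  have "\<delta> < R" using r by simp
  have neg: "u' b < 0" if b: "\<delta> < b" "b \<le> R" for b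
  proof -
    have "continuous_on {\<delta>..R} u"
      by (rule has_C1_derivative_continuous [OF u])
    then have "(u \<longlongrightarrow> u \<delta>) (at_right \<delta>)"
      using \<open>\<delta> < R\<close> continuous_on_Icc_at_rightD by blast
    then have "eventually (\<lambda>t. 0 < u t) (at_right \<delta>)"
      using u\<delta> by (rule order_tendstoD)
    moreover have "eventually (\<lambda>t. t \<in> {\<delta><..<b}) (at_right \<delta>)"
      using b(1) by (rule eventually_at_right_real)
    ultimately have "eventually (\<lambda>t. 0 < u t \<and> \<delta> < t \<and> t < b) (at_right \<delta>)"
      by eventually_elim auto
    then obtain c where c: "0 < u c" "\<delta> < c" "c < b"
      using eventually_happens by fastforce
    have "u c \<le> u \<delta>"
      using radial_solution_nonincreasing [of \<delta> c] c b by simp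
    have "b ^ (N - 1) * phi1 (u' b) < \<delta> ^ (N - 1) * phi1 (u' \<delta>)"
    proof (rule strict_decrease_of_DERIV_neg_somewhere [where a = \<delta> and b = b and c = c and w = w])
      show "continuous_on {\<delta>..b} (\<lambda>r. r ^ (N - 1) * phi1 (u' r))"
        by (rule continuous_on_subset [OF has_C1_derivative_continuous [OF w(1)]]) (use b in auto)
      show "w c < 0"
        using w(2) [of c] pos [of c "u c"] \<open>u c \<le> u \<delta>\<close> c b \<delta> by simp
      fix t assume t: "\<delta> < t" "t < b"
      then show "((\<lambda>r. r ^ (N - 1) * phi1 (u' r)) has_real_derivative w t) (at t)"
        using has_C1_derivative_interior [OF w(1), of t] b by simp
      show "w t \<le> 0"
        using w(2) [of t] F_nonneg [of t] t b \<delta> by simp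
    qed (use c in auto)
    then have "phi1 (u' b) < 0"
      using b \<delta> by (simp add: u'\<delta> mult_less_0_iff)
    then have "u' b \<noteq> 0" by auto
    then show ?thesis
      using radial_solution_slope_nonpos [of b] b by simp
  qed
  have "u R < u r"
  proof (rule DERIV_neg_imp_decreasing_open [OF r(2)])
    show "\<exists>y. (u has_real_derivative y) (at x) \<and> y < 0" if "r < x" "x < R" for x
      using has_C1_derivative_interior [OF u, of x] neg [of x] that r by auto
    show "continuous_on {r..R} u"
      by (rule continuous_on_subset [OF has_C1_derivative_continuous [OF u]]) (use r in auto)
  qed
  then show ?thesis by (simp add: uR)
qed

end


section \<open>The principal eigenfunction\<close>

text \<open>The sign of \<open>\<lambda>\<^sub>1\<close> is forced: for \<open>\<lambda>\<^sub>1 \<le> 0\<close> the positive eigenfunction would be nondecreasing,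
  and could not vanish at \<open>R\<close>. The strict inequality \<open>e' < 0\<close> uses that \<open>m\<close> is not identically
  zero near \<open>\<delta>\<close>: the flux of \<open>e\<close> decreases at once and never increases again.\<close>

lemma principal_eigenvalueE:
  assumes \<delta>: "0 \<le> \<delta>" "\<delta> < R"
    and m_nonneg: "\<And>r. r \<in> {\<delta>..R} \<Longrightarrow> 0 \<le> m r"
    and m_nontrivial: "\<And>a b. \<delta> \<le> a \<Longrightarrow> a < b \<Longrightarrow> b \<le> R \<Longrightarrow> \<exists>r\<in>{a..b}. m r \<noteq> 0"
    and pe: "principal_eigenvalue N \<delta> R m lam1"
  obtains e e' w where "0 < lam1"
    and "has_C1_derivative \<delta> R e e'" and "has_C1_derivative \<delta> R (\<lambda>r. r ^ (N - 1) * e' r) w"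
    and "\<And>r. \<delta> < r \<Longrightarrow> r < R \<Longrightarrow> w r = - (lam1 * (r ^ (N - 1) * m r * e r))"
    and "e' \<delta> = 0" "e R = 0"
    and "\<And>r. \<delta> \<le> r \<Longrightarrow> r < R \<Longrightarrow> 0 < e r"
    and "\<And>r. \<delta> < r \<Longrightarrow> r \<le> R \<Longrightarrow> e' r < 0"
proof -
  obtain e e' w where e: "has_C1_derivative \<delta> R e e'"
    and Q: "has_C1_derivative \<delta> R (\<lambda>r. r ^ (N - 1) * e' r) w"
    and w0: "\<And>r. \<delta> < r \<Longrightarrow> r < R \<Longrightarrow> - w r = lam1 * r ^ (N - 1) * m r * e r"
    and e'\<delta>: "e' \<delta> = 0" and eR: "e R = 0"
    and epos: "\<And>r. \<delta> \<le> r \<Longrightarrow> r < R \<Longrightarrow> 0 < e r"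
    using pe unfolding principal_eigenvalue_def eigenfunction_def by force
  have w: "w r = - (lam1 * (r ^ (N - 1) * m r * e r))" if "\<delta> < r" "r < R" for r
    using w0 [OF that] by (simp add: algebra_simps)
  have src: "0 \<le> r ^ (N - 1) * m r * e r" if "\<delta> < r" "r < R" for r
    using m_nonneg [of r] epos [of r] \<delta> that by simp
  have lam1: "0 < lam1"
  proof (rule ccontr)
    assume "\<not> 0 < lam1"
    then have lam1: "lam1 \<le> 0" by simp
    have e'_nonneg: "0 \<le> e' r" if "\<delta> \<le> r" "r \<le> R" for r
    proof -
      have "- (0 * (r - \<delta>)) \<le> e' r"
        by (rule radial_flux_ge [where k = "N - 1" and R = R and w = w])
          (use \<delta> e'\<delta> Q w src lam1 that in \<open>auto simp: mult_nonpos_nonneg\<close>)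
      then show ?thesis by simp
    qed
    have "- e R \<le> - e \<delta>"
      by (rule antimono_on_Icc_of_DERIV
          [where P = "\<lambda>r. - e r" and a = \<delta> and b = R and w = "\<lambda>r. - e' r"])
        (use \<delta> e'_nonneg has_C1_derivative_continuous [OF has_C1_derivative_minus [OF e]]
          has_C1_derivative_interior [OF has_C1_derivative_minus [OF e]] in auto)
    then show False
      using eR epos [of \<delta>] \<delta> by simp
  qed
  have "e' b < 0" if b: "\<delta> < b" "b \<le> R" for b
  proof -
    have "\<exists>c\<in>{(3 * \<delta> + b) / 4..(\<delta> + b) / 2}. m c \<noteq> 0"
      by (rule m_nontrivial) (use b in auto)
    then obtain c where c: "m c \<noteq> 0" "\<delta> < c" "c < b"
      using b by (auto simp: field_simps)
    then have "0 < m c" using m_nonneg [of c] b by simp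
    have "b ^ (N - 1) * e' b < \<delta> ^ (N - 1) * e' \<delta>"
    proof (rule strict_decrease_of_DERIV_neg_somewhere [where a = \<delta> and b = b and c = c and w = w])
      show "continuous_on {\<delta>..b} (\<lambda>r. r ^ (N - 1) * e' r)"
        by (rule continuous_on_subset [OF has_C1_derivative_continuous [OF Q]]) (use b in auto)
      show "w c < 0"
        using w [of c] \<open>0 < m c\<close> epos [of c] lam1 c b \<delta> by simp
      fix t assume t: "\<delta> < t" "t < b"
      then show "((\<lambda>r. r ^ (N - 1) * e' r) has_real_derivative w t) (at t)"
        using has_C1_derivative_interior [OF Q, of t] b by simp
      show "w t \<le> 0"
        using w [of t] src [of t] lam1 t b by simp
    qed (use c in auto)
    then show ?thesis
      using b \<delta> by (simp add: e'\<delta> mult_less_0_iff)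
  qed
  with lam1 e Q w e'\<delta> eR epos show ?thesis
    by (rule that)
qed


section \<open>Comparison with the eigenfunction: solutions shot from a small height\<close>

text \<open>Suppose \<open>u\<close> starts at a small height \<open>\<epsilon>\<close> and is still nonnegative at \<open>R\<close>. With the fluxes
  \<open>P = r\<^sup>N\<^sup>-\<^sup>1 \<phi>\<^sub>1(u')\<close> of \<open>u\<close> and \<open>Q = r\<^sup>N\<^sup>-\<^sup>1 e'\<close> of the eigenfunction \<open>e\<close>, the Wronskian
  \<open>W = P e - Q u\<close> vanishes at \<open>\<delta>\<close> and is nonnegative at \<open>R\<close>. However,
  \<open>W' \<le> - (\<lambda> - \<lambda>\<^sub>1) r\<^sup>N\<^sup>-\<^sup>1 m e u + B\<close>, where the error \<open>B\<close> comes from \<open>F \<noteq> \<lambda> m s\<close> and from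
  \<open>\<phi>\<^sub>1(u') \<noteq> u'\<close>, and is an arbitrarily small multiple of \<open>\<epsilon>\<close>.

  The main term contributes a fixed multiple of \<open>\<epsilon>\<close>: as \<open>u' = O(\<epsilon>)\<close>, one has \<open>u \<ge> \<epsilon> / 2\<close> on an
  interval \<open>[\<delta>, \<delta> + d]\<close> with \<open>d\<close> independent of \<open>\<epsilon>\<close>, and \<open>r\<^sup>N\<^sup>-\<^sup>1 m e = - Q' / \<lambda>\<^sub>1\<close> has a positive
  integral there. Integrating is essential: \<open>m\<close> may have zeros, where the main term does not
  dominate the error.\<close>

lemma small_radial_solutions_negative_at_R:
  assumes \<delta>: "0 \<le> \<delta>" "\<delta> < R"
    and F_nonneg: "\<And>r s. r \<in> {\<delta>..R} \<Longrightarrow> 0 \<le> F r s"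
    and F_0: "\<And>r. r \<in> {\<delta>..R} \<Longrightarrow> F r 0 = 0"
    and lim: "uniform_limit {\<delta>..R} (\<lambda>s r. F r s / s) (\<lambda>r. lam * m r) (at_right 0)"
    and m_cont: "continuous_on {\<delta>..R} m"
    and m_nonneg: "\<And>r. r \<in> {\<delta>..R} \<Longrightarrow> 0 \<le> m r"
    and m_nontrivial: "\<And>a b. \<delta> \<le> a \<Longrightarrow> a < b \<Longrightarrow> b \<le> R \<Longrightarrow> \<exists>r\<in>{a..b}. m r \<noteq> 0"
    and pe: "principal_eigenvalue N \<delta> R m lam1" and lam: "lam1 < lam"
    and b: "0 < b"
  obtains \<epsilon> where "0 < \<epsilon>" "\<epsilon> \<le> b"
    and "\<And>u u'. radial_solution N \<delta> R F u u' \<Longrightarrow> u \<delta> = \<epsilon> \<Longrightarrow> u R < 0"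
proof -
  define k where "k = N - 1"
  obtain e e' w where lam1: "0 < lam1" and e: "has_C1_derivative \<delta> R e e'"
    and Q: "has_C1_derivative \<delta> R (\<lambda>r. r ^ k * e' r) w"
    and w: "\<And>r. \<delta> < r \<Longrightarrow> r < R \<Longrightarrow> w r = - (lam1 * (r ^ k * m r * e r))"
    and e'\<delta>: "e' \<delta> = 0" and eR: "e R = 0"
    and epos: "\<And>r. \<delta> \<le> r \<Longrightarrow> r < R \<Longrightarrow> 0 < e r"
    and e'neg: "\<And>r. \<delta> < r \<Longrightarrow> r \<le> R \<Longrightarrow> e' r < 0"
    by (rule principal_eigenvalueE [OF \<delta> _ _ pe];
        rule m_nonneg m_nontrivial that [unfolded k_def]; assumption)
  have R: "0 < R" using \<delta> by simp
  obtain M where M: "0 < M" "\<And>r. \<delta> \<le> r \<Longrightarrow> r \<le> R \<Longrightarrow> m r \<le> M"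
    using continuous_on_Icc_bounded_above [OF m_cont] by blast
  obtain E where E: "0 < E" "\<And>r. \<delta> \<le> r \<Longrightarrow> r \<le> R \<Longrightarrow> r ^ k * e r \<le> E"
  proof (rule continuous_on_Icc_bounded_above [of \<delta> R "\<lambda>r. r ^ k * e r"])
    show "continuous_on {\<delta>..R} (\<lambda>r. r ^ k * e r)"
      by (intro continuous_intros has_C1_derivative_continuous [OF e])
  qed blast
  obtain E' where E': "0 < E'" "\<And>r. \<delta> \<le> r \<Longrightarrow> r \<le> R \<Longrightarrow> - (r ^ k * e' r) \<le> E'"
    by (rule continuous_on_Icc_bounded_above
        [OF has_C1_derivative_continuous [OF has_C1_derivative_minus [OF Q]]]) blast
  define C where "C = lam * M + 1"
  have C: "0 < C" using lam lam1 M by (simp add: C_def add_pos_pos)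
  define d where "d = min ((R - \<delta>) / 2) (1 / (2 * C * R))"
  have d: "0 < d" "d < R - \<delta>" "C * R * d \<le> 1 / 2"
  proof -
    show "0 < d" "d < R - \<delta>"
      using \<delta> C R by (auto simp: d_def min_less_iff_disj)
    have "C * R * d \<le> C * R * (1 / (2 * C * R))"
      using C R by (intro mult_left_mono) (auto simp: d_def)
    then show "C * R * d \<le> 1 / 2" using C R by simp
  qed
  \<comment> \<open>\<open>\<kappa> \<epsilon>\<close> will be the gain of the main term; each of the two integrated errors is kept below \<open>\<kappa> \<epsilon> / 4\<close>\<close>
  define c0 where "c0 = - ((\<delta> + d) ^ k * e' (\<delta> + d))"
  have c0: "0 < c0"
    using e'neg [of "\<delta> + d"] d \<delta> by (simp add: c0_def mult_pos_neg)
  define \<kappa> where "\<kappa> = (lam - lam1) * c0 / (2 * lam1)"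
  have \<kappa>: "0 < \<kappa>" using lam lam1 c0 by (simp add: \<kappa>_def)
  define \<eta> where "\<eta> = min 1 (\<kappa> / (4 * E * R))"
  have \<eta>: "0 < \<eta>" "\<eta> \<le> 1" "\<eta> * E * R \<le> \<kappa> / 4"
  proof -
    show "0 < \<eta>" "\<eta> \<le> 1" using \<kappa> E(1) R by (auto simp: \<eta>_def)
    have "\<eta> * (E * R) \<le> \<kappa> / (4 * E * R) * (E * R)"
      using E R by (intro mult_right_mono) (auto simp: \<eta>_def)
    then show "\<eta> * E * R \<le> \<kappa> / 4" using E R by (simp add: mult.assoc)
  qed
  obtain s0 where s0: "0 < s0"
    "\<And>r s. 0 < s \<Longrightarrow> s < s0 \<Longrightarrow> r \<in> {\<delta>..R} \<Longrightarrow> \<bar>F r s / s - lam * m r\<bar> < \<eta>"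
    using uniform_limitD [OF lim \<eta>(1)]
    by (auto simp: eventually_at_right_field dist_real_def)
  define \<epsilon> where "\<epsilon> = min b (min (s0 / 2) (\<kappa> / (4 * E' * (C * R)\<^sup>2 * R)))"
  have \<epsilon>: "0 < \<epsilon>" "\<epsilon> \<le> b" "\<epsilon> < s0" "E' * (C * R)\<^sup>2 * \<epsilon> * R \<le> \<kappa> / 4"
  proof -
    have pos: "0 < E' * (C * R)\<^sup>2 * R" using E'(1) C R by simp
    show "0 < \<epsilon>" "\<epsilon> \<le> b" "\<epsilon> < s0" using b s0(1) \<kappa> E'(1) C R by (auto simp: \<epsilon>_def)
    have "(E' * (C * R)\<^sup>2 * R) * \<epsilon> \<le> (E' * (C * R)\<^sup>2 * R) * (\<kappa> / (4 * E' * (C * R)\<^sup>2 * R))"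
      using pos by (intro mult_left_mono) (auto simp: \<epsilon>_def)
    also have "\<dots> = \<kappa> / 4" using E'(1) C R by simp
    finally show "E' * (C * R)\<^sup>2 * \<epsilon> * R \<le> \<kappa> / 4" by (simp add: mult_ac)
  qed
  have F_lower: "(lam * m r - \<eta>) * s \<le> F r s" and F_upper: "F r s \<le> C * \<epsilon>"
    if "r \<in> {\<delta>..R}" "0 \<le> s" "s \<le> \<epsilon>" for r s
  proof -
    have "(lam * m r - \<eta>) * s \<le> F r s \<and> F r s \<le> (lam * m r + \<eta>) * s"
    proof (cases "s = 0")
      case False
      then show ?thesis
        using s0(2) [of s r] that \<epsilon>(3) by (auto simp: abs_less_iff field_simps)
    qed (use F_0 that in simp)
    moreover have "(lam * m r + \<eta>) * s \<le> C * \<epsilon>"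
    proof (rule mult_mono)
      show "lam * m r + \<eta> \<le> C"
      proof -
        have "lam * m r \<le> lam * M"
          using M(2) [of r] lam lam1 that by (intro mult_left_mono) auto
        then show ?thesis using \<eta>(2) by (simp add: C_def)
      qed
    qed (use that C in auto)
    ultimately show "(lam * m r - \<eta>) * s \<le> F r s" "F r s \<le> C * \<epsilon>" by auto
  qed
  define B where "B = \<eta> * E * \<epsilon> + E' * (C * R * \<epsilon>)\<^sup>2"
  have B: "0 \<le> B" "B * R \<le> \<kappa> * \<epsilon> / 2"
  proof -
    show "0 \<le> B" using \<eta> E(1) E'(1) \<epsilon> by (auto simp: B_def)
    have "B * R = (\<eta> * E * R + E' * (C * R)\<^sup>2 * \<epsilon> * R) * \<epsilon>"
      by (simp add: B_def power2_eq_square algebra_simps)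
    also have "\<dots> \<le> (\<kappa> / 4 + \<kappa> / 4) * \<epsilon>"
      using \<eta>(3) \<epsilon>(1,4) by (intro mult_right_mono) auto
    finally show "B * R \<le> \<kappa> * \<epsilon> / 2" by simp
  qed
  have "u R < 0" if sol: "radial_solution N \<delta> R F u u'" and u\<delta>: "u \<delta> = \<epsilon>" for u u'
  proof (rule ccontr)
    assume "\<not> u R < 0"
    then have uR: "0 \<le> u R" by simp
    have u: "has_C1_derivative \<delta> R u u'" and u'\<delta>: "u' \<delta> = 0"
      and u'1: "\<And>r. \<delta> \<le> r \<Longrightarrow> r \<le> R \<Longrightarrow> -1 < u' r"
      using sol by (force simp: radial_solution_def)+
    obtain v where P: "has_C1_derivative \<delta> R (\<lambda>r. r ^ k * phi1 (u' r)) v"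
      and v: "\<And>r. \<delta> < r \<Longrightarrow> r < R \<Longrightarrow> v r = - (r ^ k * F r (u r))"
      using sol unfolding radial_solution_def k_def by auto
    have nonneg: "\<And>r. \<delta> < r \<Longrightarrow> r < R \<Longrightarrow> 0 \<le> F r (u r)"
      using F_nonneg by simp
    note solD = \<delta>(1) sol nonneg
    have u_range: "0 \<le> u r" "u r \<le> \<epsilon>" if "\<delta> \<le> r" "r \<le> R" for r
      using radial_solution_nonincreasing [OF solD, of r R]
        radial_solution_nonincreasing [OF solD, of \<delta> r] that uR u\<delta> by auto
    have u'_nonpos: "u' r \<le> 0" if "\<delta> \<le> r" "r \<le> R" for r
      by (rule radial_solution_slope_nonpos [OF solD that])
    have F_u: "F r (u r) \<le> C * \<epsilon>" if "\<delta> < r" "r < R" for r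
      using F_upper [of r "u r"] u_range [of r] that by simp
    have slope: "- (C * R * \<epsilon>) \<le> phi1 (u' r)" "- (C * R * \<epsilon>) \<le> u' r"
      if r: "\<delta> \<le> r" "r \<le> R" for r
    proof -
      have C\<epsilon>: "0 \<le> C * \<epsilon>" using C \<epsilon> by simp
      have "C * \<epsilon> * (r - \<delta>) \<le> C * \<epsilon> * R"
        using C\<epsilon> r \<delta> by (intro mult_left_mono) auto
      then show "- (C * R * \<epsilon>) \<le> phi1 (u' r)" "- (C * R * \<epsilon>) \<le> u' r"
        using radial_solution_slope_ge [OF solD C\<epsilon> F_u r] by (auto simp: mult_ac)
    qed
    have u_large: "\<epsilon> / 2 \<le> u r" if r: "\<delta> \<le> r" "r \<le> \<delta> + d" for r
    proof -
      have "u \<delta> - u r \<le> C * R * \<epsilon> * (r - \<delta>)"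
        by (rule has_C1_derivative_drop_le [OF u]) (use slope(2) r d in auto)
      moreover have "C * R * \<epsilon> * (r - \<delta>) \<le> \<epsilon> / 2"
      proof -
        have "(C * R * \<epsilon>) * (r - \<delta>) \<le> (C * R * \<epsilon>) * d"
          using C R \<epsilon> r by (intro mult_left_mono) auto
        also have "\<dots> = (C * R * d) * \<epsilon>" by simp
        also have "\<dots> \<le> 1 / 2 * \<epsilon>" using d(3) \<epsilon>(1) by (intro mult_right_mono) auto
        finally show ?thesis by simp
      qed
      ultimately show ?thesis using u\<delta> by simp
    qed
    define W where "W = (\<lambda>r. (r ^ k * phi1 (u' r)) * e r - (r ^ k * e' r) * u r)"
    define W' where "W' = (\<lambda>r. (v r * e r + e' r * (r ^ k * phi1 (u' r)))
      - (w r * u r + u' r * (r ^ k * e' r)))"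
    have W_cont: "continuous_on {\<delta>..R} W"
      unfolding W_def
      by (intro continuous_on_diff continuous_on_mult [OF has_C1_derivative_continuous [OF P]]
          continuous_on_mult [OF has_C1_derivative_continuous [OF Q]]
          has_C1_derivative_continuous [OF e] has_C1_derivative_continuous [OF u])
    have W_der: "(W has_real_derivative W' t) (at t)" if "\<delta> < t" "t < R" for t
      unfolding W_def W'_def
      by (intro DERIV_diff DERIV_mult has_C1_derivative_interior [OF P that]
          has_C1_derivative_interior [OF Q that] has_C1_derivative_interior [OF e that]
          has_C1_derivative_interior [OF u that])
    have W'_le: "W' t \<le> - ((lam - lam1) * (t ^ k * m t * e t) * u t) + B" if t: "\<delta> < t" "t < R" for t
    proof -
      have tk: "0 \<le> t ^ k" and et: "0 \<le> e t" and te: "0 \<le> t ^ k * e t"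
        using t \<delta> epos [of t] by (auto intro!: mult_nonneg_nonneg)
      have ut: "0 \<le> u t" "u t \<le> \<epsilon>" using u_range [of t] t by auto
      have 1: "(t ^ k * e t) * ((lam * m t - \<eta>) * u t) \<le> (t ^ k * e t) * F t (u t)"
        using te F_lower [of t "u t"] ut t by (intro mult_left_mono) auto
      have 2: "(t ^ k * e t) * (\<eta> * u t) \<le> \<eta> * E * \<epsilon>"
      proof -
        have "(t ^ k * e t) * (\<eta> * u t) \<le> E * (\<eta> * \<epsilon>)"
          using E te \<eta> ut t by (intro mult_mono mult_left_mono) auto
        then show ?thesis by (simp add: mult_ac)
      qed
      have 3: "(- (t ^ k * e' t)) * (u' t - phi1 (u' t)) \<le> E' * (C * R * \<epsilon>)\<^sup>2"
      proof (rule mult_mono)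
        show "- (t ^ k * e' t) \<le> E'" using E' t by simp
        have u't: "-1 < u' t" "u' t \<le> 0" using u'1 [of t] u'_nonpos [of t] t by auto
        have "\<bar>phi1 (u' t)\<bar> \<le> \<bar>C * R * \<epsilon>\<bar>"
          using slope(1) [of t] phi1_le_self [OF u't] u't t by linarith
        then have "(phi1 (u' t))\<^sup>2 \<le> (C * R * \<epsilon>)\<^sup>2"
          by (simp add: abs_le_square_iff)
        then show "u' t - phi1 (u' t) \<le> (C * R * \<epsilon>)\<^sup>2"
          using self_minus_phi1_le [OF u't] by linarith
        show "0 \<le> u' t - phi1 (u' t)"
          using phi1_le_self [OF u't] by simp
      qed (use E' in auto)
      have "W' t = - ((t ^ k * e t) * F t (u t)) + lam1 * (t ^ k * m t * e t) * u t
          + (- (t ^ k * e' t)) * (u' t - phi1 (u' t))"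
        using v [OF t] w [OF t] by (simp add: W'_def algebra_simps)
      also have "\<dots> \<le> - ((t ^ k * e t) * ((lam * m t - \<eta>) * u t)) + lam1 * (t ^ k * m t * e t) * u t
          + E' * (C * R * \<epsilon>)\<^sup>2"
        using 1 3 by linarith
      also have "\<dots> = - ((lam - lam1) * (t ^ k * m t * e t) * u t) + (t ^ k * e t) * (\<eta> * u t)
          + E' * (C * R * \<epsilon>)\<^sup>2"
        by (simp add: algebra_simps)
      also have "\<dots> \<le> - ((lam - lam1) * (t ^ k * m t * e t) * u t) + B"
        using 2 by (simp add: B_def)
      finally show ?thesis .
    qed
    have src: "0 \<le> t ^ k * m t * e t" if "\<delta> < t" "t < R" for t
      using m_nonneg [of t] epos [of t] \<delta> that by simp
    define \<beta> where "\<beta> = (lam - lam1) * (\<epsilon> / 2) / lam1"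
    have \<beta>: "\<beta> * c0 = \<kappa> * \<epsilon>" "\<beta> * lam1 = (lam - lam1) * (\<epsilon> / 2)"
      using lam1 by (auto simp: \<beta>_def \<kappa>_def)
    have "W (\<delta> + d) - \<beta> * ((\<delta> + d) ^ k * e' (\<delta> + d)) - B * (\<delta> + d)
      \<le> W \<delta> - \<beta> * (\<delta> ^ k * e' \<delta>) - B * \<delta>"
    proof (rule antimono_on_Icc_of_DERIV
        [where P = "\<lambda>r. W r - \<beta> * (r ^ k * e' r) - B * r" and a = \<delta> and b = "\<delta> + d"
          and w = "\<lambda>r. W' r - \<beta> * w r - B"])
      have "continuous_on {\<delta>..R} (\<lambda>r. W r - \<beta> * (r ^ k * e' r) - B * r)"
        by (intro continuous_on_diff W_cont continuous_on_id
            continuous_on_mult_left [OF has_C1_derivative_continuous [OF Q]] continuous_on_mult_left)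
      then show "continuous_on {\<delta>..\<delta> + d} (\<lambda>r. W r - \<beta> * (r ^ k * e' r) - B * r)"
        by (rule continuous_on_subset) (use d in auto)
      fix t assume t0: "\<delta> < t" "t < \<delta> + d"
      then have t: "\<delta> < t" "t < R" using d by auto
      show "((\<lambda>r. W r - \<beta> * (r ^ k * e' r) - B * r) has_real_derivative W' t - \<beta> * w t - B) (at t)"
        using DERIV_diff [OF DERIV_diff [OF W_der [OF t]
            DERIV_cmult [OF has_C1_derivative_interior [OF Q t], of \<beta>]]
            DERIV_cmult [OF DERIV_ident, of B]] by simp
      have "(lam - lam1) * (t ^ k * m t * e t) * (\<epsilon> / 2) \<le> (lam - lam1) * (t ^ k * m t * e t) * u t"
        using u_large [of t] src [OF t] lam t0 by (intro mult_left_mono) auto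
      moreover have "\<beta> * w t = - ((\<beta> * lam1) * (t ^ k * m t * e t))"
        using w [OF t] by simp
      ultimately show "W' t - \<beta> * w t - B \<le> 0"
        using W'_le [OF t] by (simp add: \<beta>(2) mult_ac)
    qed (use d in auto)
    then have W1: "W (\<delta> + d) \<le> - \<kappa> * \<epsilon> + B * d"
      using \<beta>(1) by (simp add: W_def u'\<delta> e'\<delta> c0_def algebra_simps)
    have "W R - B * R \<le> W (\<delta> + d) - B * (\<delta> + d)"
    proof (rule antimono_on_Icc_of_DERIV
        [where P = "\<lambda>r. W r - B * r" and a = \<delta> and b = R and w = "\<lambda>r. W' r - B"])
      show "continuous_on {\<delta>..R} (\<lambda>r. W r - B * r)"
        by (intro continuous_on_diff W_cont continuous_on_id continuous_on_mult_left)
      fix t assume t: "\<delta> < t" "t < R"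
      show "((\<lambda>r. W r - B * r) has_real_derivative W' t - B) (at t)"
        using DERIV_diff [OF W_der [OF t] DERIV_cmult [OF DERIV_ident, of B]] by simp
      have "0 \<le> (lam - lam1) * (t ^ k * m t * e t) * u t"
        using mult_nonneg_nonneg [OF mult_nonneg_nonneg [OF _ src [OF t]], of "lam - lam1" "u t"]
          lam u_range [of t] t by simp
      then show "W' t - B \<le> 0" using W'_le [OF t] by simp
    qed (use d in auto)
    then have "W R \<le> - \<kappa> * \<epsilon> + B * (R - \<delta>)"
      using W1 by (simp add: algebra_simps)
    moreover have "B * (R - \<delta>) \<le> B * R"
      using B(1) \<delta> by (intro mult_left_mono) auto
    ultimately have "W R \<le> - (\<kappa> * \<epsilon> / 2)" using B(2) by simp
    moreover have "0 < \<kappa> * \<epsilon>" using \<kappa> \<epsilon> by simp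
    moreover have "0 \<le> W R"
      using e'neg [of R] uR R \<delta> by (simp add: W_def eR mult_nonneg_nonpos mult_nonpos_nonneg)
    ultimately show False by linarith
  qed
  then show ?thesis using that [OF \<epsilon>(1,2)] by blast
qed


section \<open>The integral operator of the initial value problem\<close>

locale radial_ivp =
  fixes N :: nat and \<delta> R :: real and F :: "real \<Rightarrow> real \<Rightarrow> real"
  assumes \<delta>_nonneg: "0 \<le> \<delta>" and \<delta>_less_R: "\<delta> < R"
    and F_continuous: "continuous_on ({\<delta>..R} \<times> UNIV) (\<lambda>(r, s). F r s)"
begin

text \<open>The point \<open>r = 0\<close> occurs only if \<open>\<delta> = 0\<close>. There the integral is \<open>0\<close>, hence so is the quotient,
  which is the right value: it makes the quotient continuous.\<close>

definition flux :: "(real \<Rightarrow> real) \<Rightarrow> real \<Rightarrow> real" where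
  "flux q r = integral {\<delta>..r} (\<lambda>t. t ^ (N - 1) * q t) / r ^ (N - 1)"

definition shoot :: "real \<Rightarrow> (real \<Rightarrow> real) \<Rightarrow> real \<Rightarrow> real" where
  "shoot a v r = a - integral {\<delta>..r} (\<lambda>s. phi1_inv (flux (\<lambda>t. F t (v t)) s))"

lemma flux_at_start [simp]: "flux q \<delta> = 0"
  by (simp add: flux_def)

lemma shoot_at_start [simp]: "shoot a v \<delta> = a"
  by (simp add: shoot_def)

lemma integrable_weight:
  assumes "continuous_on {\<delta>..R} q" "r \<le> R"
  shows "(\<lambda>t. t ^ (N - 1) * q t) integrable_on {\<delta>..r}"
proof (rule integrable_continuous_real)
  show "continuous_on {\<delta>..r} (\<lambda>t. t ^ (N - 1) * q t)"
    using continuous_on_subset [OF assms(1), of "{\<delta>..r}"] assms(2)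
    by (auto intro!: continuous_intros)
qed

lemma abs_flux_le:
  assumes q: "continuous_on {\<delta>..R} q" and B: "\<And>t. t \<in> {\<delta>..R} \<Longrightarrow> \<bar>q t\<bar> \<le> B"
    and r: "r \<in> {\<delta>..R}"
  shows "\<bar>flux q r\<bar> \<le> B * (r - \<delta>)"
proof (cases "r = \<delta>")
  case False
  then have r0: "\<delta> < r" "0 < r" using r \<delta>_nonneg by auto
  have "norm (integral {\<delta>..r} (\<lambda>t. t ^ (N - 1) * q t)) \<le> r ^ (N - 1) * B * (r - \<delta>)"
  proof (rule integral_bound)
    show "continuous_on {\<delta>..r} (\<lambda>t. t ^ (N - 1) * q t)"
      using continuous_on_subset [OF q, of "{\<delta>..r}"] r by (auto intro!: continuous_intros)
    fix t assume t: "t \<in> {\<delta>..r}"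
    have "\<bar>t\<bar> ^ (N - 1) * \<bar>q t\<bar> \<le> r ^ (N - 1) * B"
      using t r B [of t] \<delta>_nonneg by (intro mult_mono power_mono) auto
    then show "norm (t ^ (N - 1) * q t) \<le> r ^ (N - 1) * B"
      by (simp add: abs_mult power_abs)
  qed (use r in auto)
  then show ?thesis
    using r0 by (simp add: flux_def pos_divide_le_eq mult_ac)
qed simp

lemma flux_diff:
  assumes "continuous_on {\<delta>..R} q1" "continuous_on {\<delta>..R} q2" "r \<in> {\<delta>..R}"
  shows "flux q1 r - flux q2 r = flux (\<lambda>t. q1 t - q2 t) r"
  using integral_diff [OF integrable_weight [OF assms(1), of r] integrable_weight [OF assms(2), of r]]
    assms(3)
  by (simp add: flux_def diff_divide_distrib right_diff_distrib)

lemma continuous_on_flux: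
  assumes q: "continuous_on {\<delta>..R} q"
  shows "continuous_on {\<delta>..R} (flux q)"
  unfolding continuous_on_def
proof
  fix x assume x: "x \<in> {\<delta>..R}"
  have num: "continuous_on {\<delta>..R} (\<lambda>r. integral {\<delta>..r} (\<lambda>t. t ^ (N - 1) * q t))"
    by (rule indefinite_integral_continuous_1 [OF integrable_weight [OF q order_refl]])
  show "(flux q \<longlongrightarrow> flux q x) (at x within {\<delta>..R})"
  proof (cases "x = \<delta>")
    case True
    have "bounded (q ` {\<delta>..R})"
      using q by (intro compact_imp_bounded compact_continuous_image) auto
    then obtain B where B: "\<And>t. t \<in> {\<delta>..R} \<Longrightarrow> \<bar>q t\<bar> \<le> B"
      by (force simp: bounded_iff)
    have "(flux q \<longlongrightarrow> 0) (at \<delta> within {\<delta>..R})"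
    proof (rule Lim_null_comparison)
      show "eventually (\<lambda>r. norm (flux q r) \<le> B * (r - \<delta>)) (at \<delta> within {\<delta>..R})"
        using abs_flux_le [OF q B] by (auto simp: eventually_at_filter)
      have "((\<lambda>r. B * (r - \<delta>)) \<longlongrightarrow> B * (\<delta> - \<delta>)) (at \<delta> within {\<delta>..R})"
        by (intro tendsto_intros)
      then show "((\<lambda>r. B * (r - \<delta>)) \<longlongrightarrow> 0) (at \<delta> within {\<delta>..R})" by simp
    qed
    then show ?thesis using True by simp
  next
    case False
    then have "x ^ (N - 1) \<noteq> 0" using x \<delta>_nonneg by simp
    then show ?thesis
      unfolding flux_def using num x
      by (intro tendsto_divide tendsto_power tendsto_ident_at) (auto simp: continuous_on_def)
  qed
qed

lemma continuous_on_source: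
  assumes "continuous_on {\<delta>..R} v"
  shows "continuous_on {\<delta>..R} (\<lambda>t. F t (v t))"
proof -
  have "continuous_on {\<delta>..R} (\<lambda>t. (\<lambda>(r, s). F r s) (t, v t))"
    by (rule continuous_on_compose2 [OF F_continuous]) (use assms in \<open>auto intro!: continuous_intros\<close>)
  then show ?thesis by simp
qed

lemma shoot_has_C1_derivative:
  assumes "continuous_on {\<delta>..R} v"
  shows "has_C1_derivative \<delta> R (shoot a v) (\<lambda>r. - phi1_inv (flux (\<lambda>t. F t (v t)) r))"
proof -
  have c: "continuous_on {\<delta>..R} (\<lambda>r. phi1_inv (flux (\<lambda>t. F t (v t)) r))"
    by (intro continuous_on_phi1_inv continuous_on_flux continuous_on_source assms)
  have "(shoot a v has_real_derivative 0 - phi1_inv (flux (\<lambda>t. F t (v t)) r)) (at r within {\<delta>..R})"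
    if "r \<in> {\<delta>..R}" for r
    unfolding shoot_def [abs_def]
    by (rule DERIV_diff [OF DERIV_const integral_has_real_derivative [OF c that]])
  then show ?thesis
    using c by (auto simp: has_C1_derivative_def intro!: continuous_intros)
qed

lemma continuous_on_shoot:
  "continuous_on {\<delta>..R} v \<Longrightarrow> continuous_on {\<delta>..R} (shoot a v)"
  by (rule has_C1_derivative_continuous [OF shoot_has_C1_derivative])

text \<open>The bound \<open>|\<phi>\<^sub>1\<^sup>-\<^sup>1| < 1\<close> makes everything in the range of the operator \<open>1\<close>-Lipschitz, whatever
  \<open>F\<close> is. This supplies the compactness, the bound for the effect of the delay, and the upper
  end of the shooting interval.\<close>

lemma shoot_lipschitz:
  assumes "continuous_on {\<delta>..R} v" "x \<in> {\<delta>..R}" "y \<in> {\<delta>..R}"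
  shows "\<bar>shoot a v x - shoot a v y\<bar> \<le> \<bar>x - y\<bar>"
proof -
  have "norm (shoot a v x - shoot a v y) \<le> 1 * norm (x - y)"
  proof (rule field_differentiable_bound [where S = "{\<delta>..R}"])
    show "(shoot a v has_real_derivative - phi1_inv (flux (\<lambda>t. F t (v t)) z)) (at z within {\<delta>..R})"
      if "z \<in> {\<delta>..R}" for z
      using shoot_has_C1_derivative [OF assms(1)] that by (simp add: has_C1_derivative_def)
    show "norm (- phi1_inv (flux (\<lambda>t. F t (v t)) z)) \<le> 1" for z
      using abs_phi1_inv_less_1 less_imp_le by auto
  qed (use assms in auto)
  then show ?thesis by simp
qed

text \<open>Fixed points solve the equation. The conclusion is about \<open>shoot (u \<delta>) u\<close> rather than \<open>u\<close>
  because \<open>u\<close> is arbitrary outside \<open>[\<delta>, R]\<close>.\<close>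

lemma radial_solution_of_fixed_point:
  assumes u: "continuous_on {\<delta>..R} u" and fp: "\<And>r. r \<in> {\<delta>..R} \<Longrightarrow> u r = shoot (u \<delta>) u r"
  shows "radial_solution N \<delta> R F (shoot (u \<delta>) u) (\<lambda>r. - phi1_inv (flux (\<lambda>t. F t (u t)) r))"
proof -
  define w where "w = (\<lambda>r. - (r ^ (N - 1) * F r (u r)))"
  have w: "continuous_on {\<delta>..R} w"
    unfolding w_def by (intro continuous_intros continuous_on_source u)
  have eq: "r ^ (N - 1) * phi1 (- phi1_inv (flux (\<lambda>t. F t (u t)) r)) = integral {\<delta>..r} w"
    if "r \<in> {\<delta>..R}" for r
  proof (cases "r = \<delta>")
    case False
    then have "r \<noteq> 0" using that \<delta>_nonneg by auto
    then show ?thesis by (simp add: flux_def w_def)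
  qed simp
  have "has_C1_derivative \<delta> R
      (\<lambda>r. r ^ (N - 1) * phi1 (- phi1_inv (flux (\<lambda>t. F t (u t)) r))) w"
    unfolding has_C1_derivative_def
  proof (intro conjI ballI w)
    fix r assume r: "r \<in> {\<delta>..R}"
    show "((\<lambda>r. r ^ (N - 1) * phi1 (- phi1_inv (flux (\<lambda>t. F t (u t)) r)))
        has_real_derivative w r) (at r within {\<delta>..R})"
      by (rule has_field_derivative_transform_within
          [OF integral_has_real_derivative [OF w r] zero_less_one r]) (rule eq [symmetric])
  qed
  moreover have "w r = - (r ^ (N - 1) * F r (shoot (u \<delta>) u r))" if "r \<in> {\<delta><..<R}" for r
    using fp [of r] that by (simp add: w_def)
  ultimately show ?thesis
    unfolding radial_solution_def
    using shoot_has_C1_derivative [OF u] abs_phi1_inv_less_1 by auto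
qed

text \<open>Limits are taken along an arbitrary filter, so as to cover both the dependence of the delayed
  solutions on their initial height and their behaviour as the delay tends to \<open>0\<close>.\<close>

lemma uniform_limit_source:
  assumes v: "continuous_on {\<delta>..R} v" and lim: "uniform_limit {\<delta>..R} V v \<F>"
  shows "uniform_limit {\<delta>..R} (\<lambda>n t. F t (V n t)) (\<lambda>t. F t (v t)) \<F>"
proof (rule uniform_limitI)
  fix e :: real assume e: "0 < e"
  have "bounded (v ` {\<delta>..R})"
    using v by (intro compact_imp_bounded compact_continuous_image) auto
  then obtain B where B: "\<And>t. t \<in> {\<delta>..R} \<Longrightarrow> \<bar>v t\<bar> \<le> B"
    by (force simp: bounded_iff)
  define K where "K = {\<delta>..R} \<times> {- (B + 1)..B + 1}"
  have "uniformly_continuous_on K (\<lambda>(r, s). F r s)"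
    using F_continuous unfolding K_def
    by (intro compact_uniformly_continuous compact_Times) (auto intro: continuous_on_subset)
  then obtain d where d: "0 < d"
    "\<And>p p'. p \<in> K \<Longrightarrow> p' \<in> K \<Longrightarrow> dist p' p < d \<Longrightarrow>
      dist ((\<lambda>(r, s). F r s) p') ((\<lambda>(r, s). F r s) p) < e"
    using e unfolding uniformly_continuous_on_def by metis
  have "eventually (\<lambda>n. \<forall>t\<in>{\<delta>..R}. dist (V n t) (v t) < min d 1) \<F>"
    using d by (intro uniform_limitD [OF lim]) auto
  then show "eventually (\<lambda>n. \<forall>t\<in>{\<delta>..R}. dist (F t (V n t)) (F t (v t)) < e) \<F>"
  proof eventually_elim
    case (elim n)
    show ?case
    proof
      fix t assume t: "t \<in> {\<delta>..R}"
      have Vt: "dist (V n t) (v t) < d" "\<bar>V n t - v t\<bar> < 1"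
        using elim t by (auto simp: dist_real_def)
      have "(t, v t) \<in> K" "(t, V n t) \<in> K"
        using B [OF t] Vt(2) t by (auto simp: K_def abs_le_iff)
      from d(2) [OF this] Vt(1) show "dist (F t (V n t)) (F t (v t)) < e"
        by (simp add: dist_Pair_Pair)
    qed
  qed
qed

lemma abs_shoot_diff_le:
  assumes V: "continuous_on {\<delta>..R} V" and v: "continuous_on {\<delta>..R} v"
    and B: "\<And>t. t \<in> {\<delta>..R} \<Longrightarrow> \<bar>F t (V t) - F t (v t)\<bar> \<le> B" and r: "r \<in> {\<delta>..R}"
  shows "\<bar>shoot a V r - shoot b v r\<bar> \<le> \<bar>a - b\<bar> + B * (R - \<delta>)\<^sup>2"
proof -
  define g where "g = (\<lambda>v s. phi1_inv (flux (\<lambda>t. F t (v t)) s))"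
  have g_cont: "continuous_on {\<delta>..r} (g u)" if "continuous_on {\<delta>..R} u" for u
  proof -
    have "continuous_on {\<delta>..R} (g u)"
      unfolding g_def by (intro continuous_on_phi1_inv continuous_on_flux continuous_on_source that)
    then show ?thesis by (rule continuous_on_subset) (use r in auto)
  qed
  have B0: "0 \<le> B" using B [OF r] by simp
  have "norm (integral {\<delta>..r} (\<lambda>s. g V s - g v s)) \<le> B * (R - \<delta>) * (r - \<delta>)"
  proof (rule integral_bound)
    show "continuous_on {\<delta>..r} (\<lambda>s. g V s - g v s)"
      by (intro continuous_on_diff g_cont V v)
    fix s assume "s \<in> {\<delta>..r}"
    then have s: "s \<in> {\<delta>..R}" using r by auto
    have "norm (g V s - g v s) \<le> \<bar>flux (\<lambda>t. F t (V t)) s - flux (\<lambda>t. F t (v t)) s\<bar>"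
      unfolding g_def real_norm_def by (rule phi1_inv_lipschitz)
    also have "\<dots> = \<bar>flux (\<lambda>t. F t (V t) - F t (v t)) s\<bar>"
      by (subst flux_diff [OF continuous_on_source [OF V] continuous_on_source [OF v] s]) (rule refl)
    also have "\<dots> \<le> B * (s - \<delta>)"
      by (intro abs_flux_le continuous_on_diff continuous_on_source V v B s)
    also have "\<dots> \<le> B * (R - \<delta>)"
      using B0 s by (intro mult_left_mono) auto
    finally show "norm (g V s - g v s) \<le> B * (R - \<delta>)" .
  qed (use r in auto)
  also have "\<dots> \<le> B * (R - \<delta>) * (R - \<delta>)"
    using B0 r by (intro mult_left_mono) auto
  finally have "\<bar>integral {\<delta>..r} (g V) - integral {\<delta>..r} (g v)\<bar> \<le> B * (R - \<delta>)\<^sup>2"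
    using integral_diff [OF integrable_continuous_real [OF g_cont [OF V]]
        integrable_continuous_real [OF g_cont [OF v]]]
    by (simp add: power2_eq_square mult.assoc)
  then show ?thesis
    unfolding shoot_def g_def by linarith
qed

lemma uniform_limit_shoot:
  assumes V: "\<And>n. continuous_on {\<delta>..R} (V n)" and v: "continuous_on {\<delta>..R} v"
    and lim: "uniform_limit {\<delta>..R} V v \<F>" and a: "(A \<longlongrightarrow> a) \<F>"
  shows "uniform_limit {\<delta>..R} (\<lambda>n. shoot (A n) (V n)) (shoot a v) \<F>"
proof (rule uniform_limitI)
  fix e :: real assume e: "0 < e"
  define B where "B = e / (2 * (R - \<delta>)\<^sup>2)"
  have B: "0 < B" "B * (R - \<delta>)\<^sup>2 = e / 2"
    using e \<delta>_less_R by (auto simp: B_def)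
  have "eventually (\<lambda>n. \<forall>t\<in>{\<delta>..R}. dist (F t (V n t)) (F t (v t)) < B) \<F>"
    by (rule uniform_limitD [OF uniform_limit_source [OF v lim] B(1)])
  moreover have "eventually (\<lambda>n. dist (A n) a < e / 2) \<F>"
    using tendstoD [OF a, of "e / 2"] e by simp
  ultimately show "eventually (\<lambda>n. \<forall>r\<in>{\<delta>..R}. dist (shoot (A n) (V n) r) (shoot a v r) < e) \<F>"
  proof eventually_elim
    case (elim n)
    show ?case
    proof
      fix r assume r: "r \<in> {\<delta>..R}"
      have "\<bar>shoot (A n) (V n) r - shoot a v r\<bar> \<le> \<bar>A n - a\<bar> + B * (R - \<delta>)\<^sup>2"
        by (rule abs_shoot_diff_le [OF V v _ r]) (use elim(1) in \<open>force simp: dist_real_def\<close>)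
      then show "dist (shoot (A n) (V n) r) (shoot a v r) < e"
        using elim(2) B(2) by (simp add: dist_real_def)
    qed
  qed
qed


section \<open>Tonelli's delayed solutions and the shooting argument\<close>

text \<open>With the argument \<open>u(t - h)\<close> in the source term, the initial value problem determines \<open>u\<close>
  successively on intervals of length \<open>h\<close>, so that it has exactly one solution and this solution
  depends continuously on the initial height, although \<open>F\<close> is merely continuous. The \<open>k\<close>-th
  Picard iterate is already exact on \<open>[\<delta>, \<delta> + k h]\<close>.\<close>

definition delay :: "real \<Rightarrow> (real \<Rightarrow> real) \<Rightarrow> real \<Rightarrow> real" where
  "delay h v t = v (max \<delta> (t - h))"

primrec iterate :: "real \<Rightarrow> real \<Rightarrow> nat \<Rightarrow> real \<Rightarrow> real" where
  "iterate h a 0 = (\<lambda>_. a)"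
| "iterate h a (Suc k) = shoot a (delay h (iterate h a k))"

lemma continuous_on_delay:
  assumes "0 \<le> h" "continuous_on {\<delta>..R} v"
  shows "continuous_on {\<delta>..R} (delay h v)"
  unfolding delay_def
  by (rule continuous_on_compose2 [OF assms(2)])
    (use assms(1) \<delta>_less_R in \<open>auto intro!: continuous_intros\<close>)

lemma continuous_on_iterate: "0 \<le> h \<Longrightarrow> continuous_on {\<delta>..R} (iterate h a k)"
  by (induction k) (auto intro!: continuous_on_shoot continuous_on_delay)

lemma iterate_at_start [simp]: "iterate h a k \<delta> = a"
  by (cases k) auto

lemma iterate_lipschitz:
  assumes "0 \<le> h" "x \<in> {\<delta>..R}" "y \<in> {\<delta>..R}"
  shows "\<bar>iterate h a k x - iterate h a k y\<bar> \<le> \<bar>x - y\<bar>"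
  by (cases k) (auto intro!: shoot_lipschitz continuous_on_delay continuous_on_iterate
      simp: assms simp del: atLeastAtMost_iff)

lemma shoot_cong:
  assumes "\<And>t. t \<in> {\<delta>..r} \<Longrightarrow> v t = v' t"
  shows "shoot a v r = shoot a v' r"
proof -
  have "flux (\<lambda>t. F t (v t)) s = flux (\<lambda>t. F t (v' t)) s" if "s \<in> {\<delta>..r}" for s
    unfolding flux_def
    by (intro arg_cong2 [where f = "(/)"] integral_cong refl) (use assms that in auto)
  then show ?thesis
    unfolding shoot_def by (intro arg_cong2 [where f = "(-)"] integral_cong refl) auto
qed

lemma iterate_stable:
  assumes "0 \<le> h" "r \<in> {\<delta>..R}" "r \<le> \<delta> + real k * h"
  shows "iterate h a (Suc k) r = iterate h a k r"
  using assms(2,3)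
proof (induction k arbitrary: r)
  case 0
  then have "r = \<delta>" by simp
  then show ?case by (simp only: iterate_at_start)
next
  case (Suc k)
  have "shoot a (delay h (iterate h a (Suc k))) r = shoot a (delay h (iterate h a k)) r"
  proof (rule shoot_cong)
    fix t assume t: "t \<in> {\<delta>..r}"
    have "0 \<le> real k * h" using assms(1) by simp
    then have "max \<delta> (t - h) \<in> {\<delta>..R}" "max \<delta> (t - h) \<le> \<delta> + real k * h"
      using t Suc.prems assms(1) by (auto simp: algebra_simps)
    then show "delay h (iterate h a (Suc k)) t = delay h (iterate h a k) t"
      unfolding delay_def by (rule Suc.IH)
  qed
  then show ?case by simp
qed

lemma uniform_limit_iterate:
  assumes "0 \<le> h"
  shows "uniform_limit {\<delta>..R} (\<lambda>a. iterate h a k) (iterate h b k) (at b within S)"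
proof (induction k)
  case 0
  have "eventually (\<lambda>a. dist a b < e) (at b within S)" if "0 < e" for e
    using that tendsto_ident_at by (rule tendstoD [rotated])
  then show ?case
    by (auto intro!: uniform_limitI elim: eventually_mono)
next
  case (Suc k)
  have "max \<delta> (t - h) \<in> {\<delta>..R}" if "t \<in> {\<delta>..R}" for t
    using that assms \<delta>_less_R by auto
  then have "uniform_limit {\<delta>..R} (\<lambda>a. delay h (iterate h a k)) (delay h (iterate h b k)) (at b within S)"
    using Suc unfolding uniform_limit_iff delay_def by (fast elim: eventually_mono)
  then show ?case
    using assms
    by (auto intro!: uniform_limit_shoot continuous_on_delay continuous_on_iterate tendsto_ident_at)
qed

text \<open>The delay is an integer fraction of \<open>R - \<delta>\<close>, so that the iterate with the corresponding index
  is exact on the whole interval.\<close>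

definition delayed_solution :: "nat \<Rightarrow> real \<Rightarrow> real \<Rightarrow> real" where
  "delayed_solution n a = iterate ((R - \<delta>) / real (Suc n)) a (Suc n)"

lemma delay_length: "0 < (R - \<delta>) / real (Suc n)"
  using \<delta>_less_R by simp

lemma delayed_solution_eq:
  assumes "r \<in> {\<delta>..R}"
  shows "delayed_solution n a r = shoot a (delay ((R - \<delta>) / real (Suc n)) (delayed_solution n a)) r"
proof -
  have "iterate ((R - \<delta>) / real (Suc n)) a (Suc (Suc n)) r
      = iterate ((R - \<delta>) / real (Suc n)) a (Suc n) r"
    by (rule iterate_stable) (use assms delay_length [of n] in \<open>auto simp del: of_nat_Suc\<close>)
  then show ?thesis
    unfolding delayed_solution_def by (metis iterate.simps(2))
qed

lemma delayed_solution_at_start [simp]: "delayed_solution n a \<delta> = a"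
  by (simp only: delayed_solution_def iterate_at_start)

lemma delayed_solution_lipschitz:
  assumes "x \<in> {\<delta>..R}" "y \<in> {\<delta>..R}"
  shows "\<bar>delayed_solution n a x - delayed_solution n a y\<bar> \<le> \<bar>x - y\<bar>"
  unfolding delayed_solution_def using delay_length [of n] assms
  by (intro iterate_lipschitz) auto

lemma continuous_on_delayed_solution: "continuous_on {\<delta>..R} (delayed_solution n a)"
  unfolding delayed_solution_def using delay_length [of n] by (intro continuous_on_iterate) auto

lemma continuous_on_delayed_solution_end: "continuous_on S (\<lambda>a. delayed_solution n a R)"
  unfolding continuous_on_def delayed_solution_def
  by (intro ballI tendsto_uniform_limitI [OF uniform_limit_iterate])
    (use delay_length [of n] \<delta>_less_R in auto)

text \<open>As the delay tends to \<open>0\<close>, delayed solutions with bounded initial heights accumulate, by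
  Arzela and Ascoli, at solutions of the problem without delay.\<close>

lemma delayed_solutions_accumulate:
  fixes A :: "nat \<Rightarrow> real"
  assumes j: "strict_mono (j :: nat \<Rightarrow> nat)" and A: "\<And>n. \<bar>A n\<bar> \<le> b"
  obtains u u' l where "radial_solution N \<delta> R F u u'" "strict_mono (l :: nat \<Rightarrow> nat)"
    and "\<And>r. r \<in> {\<delta>..R} \<Longrightarrow> (\<lambda>n. delayed_solution (j (l n)) (A (l n)) r) \<longlonglongrightarrow> u r"
proof -
  define U where "U n = delayed_solution (j n) (A n)" for n
  have lip: "\<bar>U n x - U n y\<bar> \<le> \<bar>x - y\<bar>" if "x \<in> {\<delta>..R}" "y \<in> {\<delta>..R}" for n x y
    unfolding U_def using that by (rule delayed_solution_lipschitz)
  obtain u l where u: "continuous_on {\<delta>..R} u" and l: "strict_mono (l :: nat \<Rightarrow> nat)"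
    and conv: "\<And>e. 0 < e \<Longrightarrow> \<exists>N. \<forall>n x. n \<ge> N \<and> x \<in> {\<delta>..R} \<longrightarrow> norm (U (l n) x - u x) < e"
  proof (rule Arzela_Ascoli [of "{\<delta>..R}" U "b + (R - \<delta>)"])
    show "norm (U n x) \<le> b + (R - \<delta>)" if x: "x \<in> {\<delta>..R}" for n x
    proof -
      have "\<bar>U n x - A n\<bar> \<le> \<bar>x - \<delta>\<bar>"
        using lip [of x \<delta> n] x \<delta>_less_R by (simp add: U_def)
      then show ?thesis using A [of n] x by auto
    qed
    show "\<exists>d>0. \<forall>n y. y \<in> {\<delta>..R} \<and> norm (x - y) < d \<longrightarrow> norm (U n x - U n y) < e"
      if "x \<in> {\<delta>..R}" "0 < e" for x e
      using that lip [OF that(1)] by (intro exI [of _ e]) (auto intro: le_less_trans)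
  qed auto
  have lim: "uniform_limit {\<delta>..R} (\<lambda>n. U (l n)) u sequentially"
    unfolding uniform_limit_sequentially_iff dist_norm using conv by blast
  have ptw: "(\<lambda>n. U (l n) r) \<longlonglongrightarrow> u r" if "r \<in> {\<delta>..R}" for r
    by (rule tendsto_uniform_limitI [OF lim that])
  define h where "h n = (R - \<delta>) / real (Suc (j (l n)))" for n
  have h: "0 < h n" for n
    unfolding h_def by (rule delay_length)
  have h0: "h \<longlonglongrightarrow> 0"
  proof -
    have "filterlim (\<lambda>n. j (l n)) at_top sequentially"
      using filterlim_subseq [OF strict_mono_o [OF j l]] by (simp add: o_def)
    then have "(\<lambda>n. (R - \<delta>) / real (Suc (j (l n)))) \<longlonglongrightarrow> 0"
      by (rule filterlim_compose [rotated]) real_asymp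
    then show ?thesis by (simp add: h_def [abs_def])
  qed
  have "uniform_limit {\<delta>..R} (\<lambda>n. delay (h n) (U (l n))) u sequentially"
  proof (rule uniform_limitI)
    fix e :: real assume e: "0 < e"
    have "eventually (\<lambda>n. \<forall>t\<in>{\<delta>..R}. dist (U (l n) t) (u t) < e / 2) sequentially"
      using uniform_limitD [OF lim, of "e / 2"] e by simp
    moreover have "eventually (\<lambda>n. h n < e / 2) sequentially"
      using order_tendstoD(2) [OF h0, of "e / 2"] e by simp
    ultimately show "eventually (\<lambda>n. \<forall>t\<in>{\<delta>..R}. dist (delay (h n) (U (l n)) t) (u t) < e) sequentially"
    proof eventually_elim
      case (elim n)
      show ?case
      proof
        fix t assume t: "t \<in> {\<delta>..R}"
        have "\<bar>delay (h n) (U (l n)) t - U (l n) t\<bar> \<le> \<bar>max \<delta> (t - h n) - t\<bar>"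
          unfolding delay_def by (rule lip) (use t h [of n] in auto)
        also have "\<dots> \<le> h n" using t h [of n] by auto
        finally have "\<bar>delay (h n) (U (l n)) t - U (l n) t\<bar> \<le> h n" .
        moreover have "\<bar>U (l n) t - u t\<bar> < e / 2"
          using elim(1) t by (simp add: dist_real_def)
        ultimately show "dist (delay (h n) (U (l n)) t) (u t) < e"
          using elim(2) unfolding dist_real_def by linarith
      qed
    qed
  qed
  moreover have "(\<lambda>n. A (l n)) \<longlonglongrightarrow> u \<delta>"
    using ptw [of \<delta>] \<delta>_less_R by (simp add: U_def)
  ultimately have lim': "uniform_limit {\<delta>..R} (\<lambda>n. shoot (A (l n)) (delay (h n) (U (l n))))
      (shoot (u \<delta>) u) sequentially"
    using h unfolding U_def
    by (intro uniform_limit_shoot continuous_on_delay continuous_on_delayed_solution u)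
      (auto intro: less_imp_le)
  have fp: "u r = shoot (u \<delta>) u r" if r: "r \<in> {\<delta>..R}" for r
  proof (rule LIMSEQ_unique [OF ptw [OF r]])
    have "U (l n) r = shoot (A (l n)) (delay (h n) (U (l n))) r" for n
      unfolding U_def h_def by (rule delayed_solution_eq [OF r])
    then show "(\<lambda>n. U (l n) r) \<longlonglongrightarrow> shoot (u \<delta>) u r"
      using tendsto_uniform_limitI [OF lim' r] by simp
  qed
  show ?thesis
  proof (rule that [OF radial_solution_of_fixed_point [OF u fp] l])
    fix r assume "r \<in> {\<delta>..R}"
    then show "(\<lambda>n. delayed_solution (j (l n)) (A (l n)) r) \<longlonglongrightarrow> shoot (u \<delta>) u r"
      using ptw [of r] fp [of r] by (simp add: U_def)
  qed
qed

text \<open>Delayed solutions depend continuously on the initial height, so the intermediate value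
  theorem applies to them: from height \<open>R\<close> the end point is still nonnegative because the slope is
  at most \<open>1\<close>, and from height \<open>\<epsilon>\<close> it is negative for all small delays, since otherwise a limit
  would be a solution that starts at \<open>\<epsilon>\<close> and stays nonnegative.\<close>

theorem shooting:
  assumes \<epsilon>: "0 < \<epsilon>" "\<epsilon> \<le> R"
    and neg: "\<And>u u'. radial_solution N \<delta> R F u u' \<Longrightarrow> u \<delta> = \<epsilon> \<Longrightarrow> u R < 0"
  obtains u u' where "radial_solution N \<delta> R F u u'" "\<epsilon> \<le> u \<delta>" "u \<delta> \<le> R" "u R = 0"
proof -
  have ends: "\<delta> \<in> {\<delta>..R}" "R \<in> {\<delta>..R}"
    using \<delta>_less_R by auto
  have "eventually (\<lambda>n. delayed_solution n \<epsilon> R < 0) sequentially"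
  proof (rule ccontr)
    assume "\<not> ?thesis"
    then have "\<exists>\<^sub>\<infinity>n. 0 \<le> delayed_solution n \<epsilon> R"
      by (simp add: frequently_def cofinite_eq_sequentially not_le)
    then have inf: "infinite {n. 0 \<le> delayed_solution n \<epsilon> R}"
      by (simp add: frequently_cofinite)
    define j where "j = enumerate {n. 0 \<le> delayed_solution n \<epsilon> R}"
    have j: "strict_mono j" "\<And>n. 0 \<le> delayed_solution (j n) \<epsilon> R"
      using strict_mono_enumerate [OF inf] enumerate_in_set [OF inf] by (auto simp: j_def)
    obtain u u' l where sol: "radial_solution N \<delta> R F u u'"
      and lim: "\<And>r. r \<in> {\<delta>..R} \<Longrightarrow> (\<lambda>n. delayed_solution (j (l n)) \<epsilon> r) \<longlonglongrightarrow> u r"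
      by (rule delayed_solutions_accumulate [OF j(1), of "\<lambda>_. \<epsilon>" "\<bar>\<epsilon>\<bar>"]) auto
    have "0 \<le> u R"
      using lim [OF ends(2)] j(2) by (intro LIMSEQ_le_const) auto
    moreover have "u \<delta> = \<epsilon>"
      using LIMSEQ_unique [OF lim [OF ends(1)], of \<epsilon>] by simp
    ultimately show False using neg [OF sol] by simp
  qed
  then obtain n0 where n0: "\<And>n. n0 \<le> n \<Longrightarrow> delayed_solution n \<epsilon> R < 0"
    by (auto simp: eventually_sequentially)
  have "\<exists>a. \<epsilon> \<le> a \<and> a \<le> R \<and> delayed_solution n a R = 0" if "n0 \<le> n" for n
  proof (rule IVT')
    show "delayed_solution n \<epsilon> R \<le> 0" using n0 [OF that] by simp
    show "0 \<le> delayed_solution n R R"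
      using delayed_solution_lipschitz [OF ends, of n R] \<delta>_nonneg \<delta>_less_R by auto
    show "continuous_on {\<epsilon>..R} (\<lambda>a. delayed_solution n a R)"
      by (rule continuous_on_delayed_solution_end)
  qed (rule \<epsilon>(2))
  then have "\<forall>n. \<exists>a. \<epsilon> \<le> a \<and> a \<le> R \<and> delayed_solution (n0 + n) a R = 0"
    by simp
  from choice [OF this] obtain A
    where A: "\<And>n. \<epsilon> \<le> A n \<and> A n \<le> R \<and> delayed_solution (n0 + n) (A n) R = 0"
    by blast
  have j: "strict_mono (\<lambda>n. n0 + n)"
    by (simp add: strict_mono_def)
  have "\<bar>A n\<bar> \<le> R" for n using A [of n] \<epsilon>(1) by auto
  then obtain u u' l where sol: "radial_solution N \<delta> R F u u'"
    and lim: "\<And>r. r \<in> {\<delta>..R} \<Longrightarrow> (\<lambda>n. delayed_solution (n0 + l n) (A (l n)) r) \<longlonglongrightarrow> u r"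
    using delayed_solutions_accumulate [OF j] by metis
  have "\<epsilon> \<le> u \<delta>" "u \<delta> \<le> R"
    using lim [OF ends(1)] A by (auto intro: LIMSEQ_le_const LIMSEQ_le_const2)
  moreover have "u R = 0"
    using LIMSEQ_unique [OF lim [OF ends(2)], of 0] A by simp
  ultimately show ?thesis using that [OF sol] by blast
qed

end


section \<open>Nonexistence for small \<open>\<lambda>\<close> and existence above \<open>\<lambda>\<^sub>1\<close>\<close>

lemma source_vanishes_at_0:
  assumes R: "0 < R" "R < \<alpha>"
    and cont: "continuous_on ({\<delta>..R} \<times> {0..<\<alpha>}) (\<lambda>(r, s). f r s)"
    and lim: "uniform_limit {\<delta>..R} (\<lambda>s r. f r s / s) m (at_right 0)" and r: "r \<in> {\<delta>..R}"
  shows "f r 0 = (0 :: real)"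
proof -
  have "continuous_on {0..R} (\<lambda>s. (\<lambda>(r, s). f r s) (r, s))"
    by (rule continuous_on_compose2 [OF cont]) (use R r in \<open>auto intro!: continuous_intros\<close>)
  then have 1: "((\<lambda>s. f r s) \<longlongrightarrow> f r 0) (at_right 0)"
    using continuous_on_Icc_at_rightD [of 0 R "f r"] R by simp
  have "((\<lambda>s. s * (f r s / s)) \<longlongrightarrow> 0 * m r) (at_right 0)"
    by (intro tendsto_mult tendsto_ident_at tendsto_uniform_limitI [OF lim r])
  moreover have "eventually (\<lambda>s. s * (f r s / s) = f r s) (at_right 0)"
    by (auto simp: eventually_at_filter)
  ultimately have "((\<lambda>s. f r s) \<longlongrightarrow> 0) (at_right 0)"
    using Lim_transform_eventually by fastforce
  with 1 show ?thesis
    by (rule tendsto_unique [rotated]) simp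
qed

text \<open>Near \<open>s = 0\<close> the bound comes from the uniform limit, and away from \<open>0\<close> from the boundedness of
  \<open>f\<close> on \<open>[\<delta>, R] \<times> [0, R]\<close>, which needs \<open>R < \<alpha>\<close>.\<close>

lemma source_linear_bound:
  assumes R: "0 < R" "R < \<alpha>"
    and cont: "continuous_on ({\<delta>..R} \<times> {0..<\<alpha>}) (\<lambda>(r, s). f r s)"
    and lim: "uniform_limit {\<delta>..R} (\<lambda>s r. f r s / s) m (at_right 0)"
    and m: "continuous_on {\<delta>..R} m"
  obtains C :: real where "0 < C" "\<And>r s. r \<in> {\<delta>..R} \<Longrightarrow> s \<in> {0..R} \<Longrightarrow> f r s \<le> C * s"
proof -
  obtain M where M: "0 < M" "\<And>r. \<delta> \<le> r \<Longrightarrow> r \<le> R \<Longrightarrow> m r \<le> M"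
    using continuous_on_Icc_bounded_above [OF m] by blast
  obtain s0 where s0: "0 < s0"
    "\<And>r s. 0 < s \<Longrightarrow> s < s0 \<Longrightarrow> r \<in> {\<delta>..R} \<Longrightarrow> \<bar>f r s / s - m r\<bar> < 1"
    using uniform_limitD [OF lim zero_less_one]
    by (auto simp: eventually_at_right_field dist_real_def)
  have "bounded ((\<lambda>(r, s). f r s) ` ({\<delta>..R} \<times> {0..R}))"
    by (intro compact_imp_bounded compact_continuous_image compact_Times continuous_on_subset [OF cont])
      (use R in auto)
  then obtain B where B: "0 < B" "\<And>r s. r \<in> {\<delta>..R} \<Longrightarrow> s \<in> {0..R} \<Longrightarrow> \<bar>f r s\<bar> \<le> B"
    unfolding bounded_pos by force
  have "f r s \<le> max (M + 1) (B / s0) * s" if rs: "r \<in> {\<delta>..R}" "s \<in> {0..R}" for r s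
  proof -
    consider "s = 0" | "0 < s" "s < s0" | "s0 \<le> s" using rs by force
    then show ?thesis
    proof cases
      case 1
      then show ?thesis using source_vanishes_at_0 [OF R cont lim rs(1)] by simp
    next
      case 2
      have "f r s / s \<le> M + 1"
        using s0(2) [OF 2 rs(1)] M(2) [of r] rs by (auto simp: abs_less_iff)
      then show ?thesis
        using 2 by (simp add: pos_divide_le_eq max_mult_distrib_right)
    next
      case 3
      have "f r s \<le> B / s0 * s0" using B(2) [OF rs] s0(1) by auto
      also have "\<dots> \<le> B / s0 * s" using 3 B(1) s0(1) by (intro mult_left_mono) auto
      also have "\<dots> \<le> max (M + 1) (B / s0) * s"
        using 3 s0(1) by (intro mult_right_mono) auto
      finally show ?thesis .
    qed
  qed
  then show ?thesis using M(1) by (intro that [of "max (M + 1) (B / s0)"]) auto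
qed

text \<open>For a positive solution, integrating the equation twice gives
  \<open>u(\<delta>) \<le> \<lambda> C R\<^sup>2 u(\<delta>)\<close>, whence \<open>\<lambda> \<ge> 1 / (C R\<^sup>2)\<close>.\<close>

lemma positive_solution_parameter_ge:
  assumes \<delta>: "0 \<le> \<delta>" "\<delta> < R" and lam: "0 < lam"
    and f_nonneg: "\<And>r s. r \<in> {\<delta>..R} \<Longrightarrow> s \<in> {0..<\<alpha>} \<Longrightarrow> 0 \<le> f r s"
    and C: "0 < C" "\<And>r s. r \<in> {\<delta>..R} \<Longrightarrow> s \<in> {0..R} \<Longrightarrow> f r s \<le> C * s"
    and u: "positive_solution N \<delta> R \<alpha> f lam u"
  shows "1 / (C * R\<^sup>2) \<le> lam"
proof -
  obtain u' w where C1: "has_C1_derivative \<delta> R u u'"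
    and u'1: "\<And>r. r \<in> {\<delta>..R} \<Longrightarrow> \<bar>u' r\<bar> < 1"
    and w: "has_C1_derivative \<delta> R (\<lambda>r. r ^ (N - 1) * phi1 (u' r)) w"
    and eq: "\<And>r. r \<in> {\<delta><..<R} \<Longrightarrow> w r + lam * r ^ (N - 1) * f r (u r) = 0"
    and bc: "u' \<delta> = 0" "u R = 0"
    using u unfolding positive_solution_def by blast
  have range: "\<And>r. r \<in> {\<delta>..R} \<Longrightarrow> u r \<in> {0..<\<alpha>}" and pos: "0 < u \<delta>"
    using u \<delta> by (auto simp: positive_solution_def)
  have eq': "w r = - (r ^ (N - 1) * (lam * f r (u r)))" if "r \<in> {\<delta><..<R}" for r
    using eq [OF that] by (simp add: algebra_simps)
  have sol: "radial_solution N \<delta> R (\<lambda>r s. lam * f r s) u u'"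
    unfolding radial_solution_def using C1 u'1 w eq' bc(1) by blast
  have nonneg: "0 \<le> lam * f r (u r)" if "\<delta> < r" "r < R" for r
    using f_nonneg [of r "u r"] range [of r] that lam by simp
  note solD = \<delta>(1) sol nonneg
  have le: "u r \<le> u \<delta>" if "r \<in> {\<delta>..R}" for r
    using radial_solution_nonincreasing [OF solD, of \<delta> r] that by simp
  have "u \<delta> - u R \<le> 1 * (R - \<delta>)"
  proof (rule has_C1_derivative_drop_le [OF C1])
    show "- 1 \<le> u' t" if "\<delta> < t" "t < R" for t
      using u'1 [of t] that by (simp add: abs_less_iff)
  qed (use \<delta> in auto)
  then have "u \<delta> \<le> R" using \<delta> bc(2) by simp
  define B where "B = lam * (C * u \<delta>)"
  have B: "0 \<le> B" using lam C pos by (simp add: B_def)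
  have "lam * f r (u r) \<le> B" if r: "\<delta> < r" "r < R" for r
  proof -
    have "f r (u r) \<le> C * u r"
      using C(2) [of r "u r"] range [of r] le [of r] \<open>u \<delta> \<le> R\<close> r by simp
    also have "\<dots> \<le> C * u \<delta>"
      using C(1) le [of r] r by (intro mult_left_mono) auto
    finally show ?thesis
      unfolding B_def using lam by (intro mult_left_mono) auto
  qed
  note slope = radial_solution_slope_ge(2) [OF solD B this]
  have "u \<delta> - u R \<le> B * R * (R - \<delta>)"
  proof (rule has_C1_derivative_drop_le [OF C1])
    fix t assume t: "\<delta> < t" "t < R"
    have "B * (t - \<delta>) \<le> B * R"
      using B t \<delta> by (intro mult_left_mono) auto
    then show "- (B * R) \<le> u' t"
      using slope [of t] t by simp
  qed (use \<delta> in auto)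
  also have "\<dots> \<le> B * R * R"
    using B \<delta> by (intro mult_left_mono) auto
  also have "\<dots> = (lam * (C * R\<^sup>2)) * u \<delta>"
    by (simp add: B_def power2_eq_square)
  finally have "1 \<le> lam * (C * R\<^sup>2)"
    using pos bc(2) by simp
  moreover have "0 < C * R\<^sup>2" using C(1) \<delta> by simp
  ultimately show ?thesis by (simp add: pos_divide_le_eq)
qed

text \<open>Outside \<open>0 \<le> s \<le> R\<close> the source term is replaced by its values at \<open>s = 0\<close> and \<open>s = R\<close>, so that
  the initial value problem makes sense globally. The solution found by shooting decreases from a
  height of at most \<open>R\<close> to \<open>0\<close>, so it stays in the range where nothing was changed.\<close>

lemma positive_solution_exists:
  assumes \<delta>: "0 \<le> \<delta>" "\<delta> < R" and \<alpha>: "R < \<alpha>"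
    and cont: "continuous_on ({\<delta>..R} \<times> {0..<\<alpha>}) (\<lambda>(r, s). f r s)"
    and f_nonneg: "\<And>r s. r \<in> {\<delta>..R} \<Longrightarrow> s \<in> {0..<\<alpha>} \<Longrightarrow> 0 \<le> f r s"
    and f_pos: "\<And>r s. r \<in> {\<delta>..R} \<Longrightarrow> s \<in> {0<..<\<alpha>} \<Longrightarrow> 0 < f r s"
    and lim: "uniform_limit {\<delta>..R} (\<lambda>s r. f r s / s) m (at_right 0)"
    and m_cont: "continuous_on {\<delta>..R} m"
    and m_nonneg: "\<And>r. r \<in> {\<delta>..R} \<Longrightarrow> 0 \<le> m r"
    and m_nontrivial: "\<And>a b. \<delta> \<le> a \<Longrightarrow> a < b \<Longrightarrow> b \<le> R \<Longrightarrow> \<exists>r\<in>{a..b}. m r \<noteq> 0"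
    and pe: "principal_eigenvalue N \<delta> R m lam1" and lam1: "0 < lam1" and lam: "lam1 < lam"
  shows "\<exists>u. positive_solution N \<delta> R \<alpha> f lam u"
proof -
  have R: "0 < R" using \<delta> by simp
  define F where "F = (\<lambda>r s. lam * f r (max 0 (min R s)))"
  have F_eq: "F r s = lam * f r s" if "0 \<le> s" "s \<le> R" for r s
    using that by (simp add: F_def)
  have F_nonneg: "0 \<le> F r s" if "r \<in> {\<delta>..R}" for r s
    using f_nonneg [OF that, of "max 0 (min R s)"] lam lam1 R \<alpha> by (simp add: F_def)
  have "continuous_on ({\<delta>..R} \<times> UNIV) (\<lambda>p. (\<lambda>(r, s). f r s) (fst p, max 0 (min R (snd p))))"
    by (rule continuous_on_compose2 [OF cont])
      (use R \<alpha> in \<open>auto intro!: continuous_intros\<close>)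
  then have "continuous_on ({\<delta>..R} \<times> UNIV) (\<lambda>(r, s). F r s)"
    by (auto simp: F_def case_prod_unfold intro!: continuous_on_mult_left)
  then interpret radial_ivp N \<delta> R F
    using \<delta> by unfold_locales
  have F_0: "F r 0 = 0" if "r \<in> {\<delta>..R}" for r
    using source_vanishes_at_0 [OF R \<alpha> cont lim that] R by (simp add: F_eq)
  have F_lim: "uniform_limit {\<delta>..R} (\<lambda>s r. F r s / s) (\<lambda>r. lam * m r) (at_right 0)"
  proof (rule uniform_limitI)
    fix e :: real assume "0 < e"
    then have "eventually (\<lambda>s. \<forall>r\<in>{\<delta>..R}. dist (f r s / s) (m r) < e / lam) (at_right 0)"
      using lam lam1 by (intro uniform_limitD [OF lim]) auto
    moreover have "eventually (\<lambda>s. s \<in> {0<..<R}) (at_right 0)"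
      using R by (rule eventually_at_right_real)
    ultimately show "eventually (\<lambda>s. \<forall>r\<in>{\<delta>..R}. dist (F r s / s) (lam * m r) < e) (at_right 0)"
    proof eventually_elim
      case (elim s)
      have "dist (F r s / s) (lam * m r) = lam * dist (f r s / s) (m r)" for r
      proof -
        have "F r s / s - lam * m r = lam * (f r s / s - m r)"
          using elim(2) by (simp add: F_eq right_diff_distrib)
        then show ?thesis using lam lam1 by (simp add: dist_real_def abs_mult)
      qed
      then show ?case
        using elim(1) lam lam1 by (auto simp: pos_less_divide_eq mult.commute)
    qed
  qed
  obtain \<epsilon> where \<epsilon>: "0 < \<epsilon>" "\<epsilon> \<le> R"
    and neg: "\<And>u u'. radial_solution N \<delta> R F u u' \<Longrightarrow> u \<delta> = \<epsilon> \<Longrightarrow> u R < 0"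
    by (rule small_radial_solutions_negative_at_R [OF \<delta> _ _ F_lim m_cont _ _ pe lam R];
        rule F_nonneg F_0 m_nonneg m_nontrivial that; assumption)
  obtain u u' where sol: "radial_solution N \<delta> R F u u'"
    and "\<epsilon> \<le> u \<delta>" and u\<delta>_le: "u \<delta> \<le> R" and uR: "u R = 0"
    by (rule shooting [OF \<epsilon>]; rule neg that; assumption)
  then have u\<delta>: "0 < u \<delta>" "u \<delta> \<le> R" using \<epsilon>(1) by auto
  have nonneg: "\<And>r. \<delta> < r \<Longrightarrow> r < R \<Longrightarrow> 0 \<le> F r (u r)"
    using F_nonneg by simp
  note solD = \<delta>(1) sol nonneg
  have range: "0 \<le> u r" "u r \<le> R" if "r \<in> {\<delta>..R}" for r
    using radial_solution_nonincreasing [OF solD, of r R]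
      radial_solution_nonincreasing [OF solD, of \<delta> r] that u\<delta> uR by auto
  have pos: "0 < u r" if r: "\<delta> \<le> r" "r < R" for r
  proof (rule radial_solution_positive [OF \<delta>(1) sol nonneg _ u\<delta>(1) uR r])
    show "0 < F r s" if "\<delta> < r" "r < R" "0 < s" "s \<le> u \<delta>" for r s
      using f_pos [of r s] that u\<delta>(2) \<alpha> lam lam1 by (simp add: F_eq)
  qed
  obtain w where w: "has_C1_derivative \<delta> R (\<lambda>r. r ^ (N - 1) * phi1 (u' r)) w"
    "\<And>r. r \<in> {\<delta><..<R} \<Longrightarrow> w r = - (r ^ (N - 1) * F r (u r))"
    using sol by (auto simp: radial_solution_def)
  have "w r + lam * r ^ (N - 1) * f r (u r) = 0" if "r \<in> {\<delta><..<R}" for r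
    using w(2) [OF that] range [of r] that by (simp add: F_eq)
  then have "positive_solution N \<delta> R \<alpha> f lam u"
    unfolding positive_solution_def
  proof (intro conjI)
    show "\<forall>r\<in>{\<delta>..R}. u r \<in> {0..<\<alpha>}"
      using range \<alpha> by fastforce
    show "\<forall>r\<in>{\<delta>..<R}. 0 < u r"
      using pos by simp
  qed (rule exI [of _ u'], rule exI [of _ w], use sol w(1) uR in \<open>auto simp: radial_solution_def\<close>)
  then show ?thesis by blast
qed

theorem corollary1p1:
  fixes N :: nat and R \<delta> \<alpha> lam1 :: real
    and f :: "real \<Rightarrow> real \<Rightarrow> real" and m :: "real \<Rightarrow> real"
  assumes "N \<ge> 2" and "0 < R" and "0 \<le> \<delta>" and "\<delta> < R" and "R < \<alpha>"
    and "continuous_on ({\<delta>..R} \<times> {0..<\<alpha>}) (\<lambda>(r, s). f r s)"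
    and "\<And>r s. r \<in> {\<delta>..R} \<Longrightarrow> s \<in> {0..<\<alpha>} \<Longrightarrow> f r s \<ge> 0"
    and "\<And>r s. r \<in> {\<delta>..R} \<Longrightarrow> s \<in> {0<..<\<alpha>} \<Longrightarrow> f r s > 0"
    and "uniform_limit {\<delta>..R} (\<lambda>s r. f r s / s) m (at_right 0)"
    and "continuous_on {\<delta>..R} m"
    and "\<And>r. r \<in> {\<delta>..R} \<Longrightarrow> m r \<ge> 0"
    and "\<And>a b. \<delta> \<le> a \<Longrightarrow> a < b \<Longrightarrow> b \<le> R \<Longrightarrow> \<exists>r\<in>{a..b}. m r \<noteq> 0"
    and "principal_eigenvalue N \<delta> R m lam1"
  shows "\<exists>lam_star. 0 < lam_star \<and> lam_star \<le> lam1 \<and>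
           (\<forall>lam. 0 < lam \<and> lam < lam_star \<longrightarrow> \<not> (\<exists>u. positive_solution N \<delta> R \<alpha> f lam u)) \<and>
           (\<forall>lam>lam1. \<exists>u. positive_solution N \<delta> R \<alpha> f lam u)"
proof -
  have lam1: "0 < lam1"
    by (rule principal_eigenvalueE [OF assms(3,4) _ _ assms(13)]) (use assms(11,12) in auto)
  obtain C where C: "0 < C" "\<And>r s. r \<in> {\<delta>..R} \<Longrightarrow> s \<in> {0..R} \<Longrightarrow> f r s \<le> C * s"
    using source_linear_bound [OF assms(2,5,6,9,10)] by blast
  show ?thesis
  proof (intro exI [of _ "min lam1 (1 / (C * R\<^sup>2))"] conjI allI impI notI)
    show "0 < min lam1 (1 / (C * R\<^sup>2))" using lam1 C(1) assms(2) by simp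
    show "False" if lam: "0 < lam \<and> lam < min lam1 (1 / (C * R\<^sup>2))"
      and ex: "\<exists>u. positive_solution N \<delta> R \<alpha> f lam u" for lam
    proof -
      obtain u where u: "positive_solution N \<delta> R \<alpha> f lam u" using ex ..
      have "1 / (C * R\<^sup>2) \<le> lam"
        by (rule positive_solution_parameter_ge [OF assms(3,4) _ _ C u])
          (use lam assms(7) in auto)
      then show False using lam by simp
    qed
    show "\<exists>u. positive_solution N \<delta> R \<alpha> f lam u" if "lam1 < lam" for lam
      by (rule positive_solution_exists [OF assms(3-13) lam1 that])
  qed simp
qed

end
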